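(* There is a universal constant $c\in(0,\infty)$ such that for every $p\in(1,\infty)$ the following holds. For arbitrarily large $n\in\mathbb{N}$ there exists an $n$-point metric space $(X_n,d_{X_n})$ such that for every $\alpha\in(0,1]$ we have $$c_{(\mathscr{P}_p(\mathbb{R}^3),\mathsf{W}_p)}(X_n,d_{X_n}^\alpha)\ \ge\ \begin{cases} c\,(\log n)^{\alpha-\frac1p} & \text{if } p\in(1,2],\\ c\,(\log n)^{\alpha+\frac1p-1} & \text{if } p\in(2,\infty).\end{cases}$$
   Context: $\mathbb{R}^3$ carries the Euclidean metric. For a complete separable metric space $(Y,d_Y)$ and $p\ge 1$, $\mathscr{P}_p(Y)$ is the set of Borel probability measures $\mu$ on $Y$ with $\int_Y d_Y(y,y_0)^p\,d\mu(y)<\infty$ for some (hence all) $y_0\in Y$, equipped with the Wasserstein metric $\mathsf{W}_p(\mu,\nu)=\inf_{\pi\in\Pi(\mu,\nu)}\big(\iint_{Y\times Y} d_Y(x,y)^p\,d\pi(x,y)\big)^{1/p}$, where $\Pi(\mu,\nu)$ is the set of couplings of $\mu$ and $\nu$. Distortion: a map $f:X\to Y$ between metric spaces has distortion at most $D\in[1,\infty]$ if there is $s\in(0,\infty)$ with $s\,d_X(x,y)\le d_Y(f(x),f(y))\le Ds\,d_X(x,y)$ for all $x,y\in X$. $c_{(Y,d_Y)}(X,d_X)$ is the infimum of those $D$ for which some map $f:X\to Y$ has distortion at most $D$. Logarithms are natural. *)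

theory Defs
  imports "HOL-Probability.Probability"
begin

definition wasserstein_space :: "real \<Rightarrow> 'a::polish_space measure set"
  where "wasserstein_space p =
    {\<mu>. prob_space \<mu> \<and> sets \<mu> = sets borel \<and>
         (\<exists>y\<^sub>0. integrable \<mu> (\<lambda>y. dist y y\<^sub>0 powr p))}"

definition couplings ::
    "'a::polish_space measure \<Rightarrow> 'a measure \<Rightarrow> ('a \<times> 'a) measure set"
  where "couplings \<mu> \<nu> =
    {\<pi>. prob_space \<pi> \<and> sets \<pi> = sets borel \<and>
         distr \<pi> borel fst = \<mu> \<and> distr \<pi> borel snd = \<nu>}"

(* The Bochner integral of a non-integrable function is 0, so this formula is meaningful only
   when the cost is integrable for every coupling. The lemma below shows that this holds for
   measures with finite p-th moments, which are the only ones the metric is applied to. *)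
definition wasserstein_dist ::
    "real \<Rightarrow> 'a::polish_space measure \<Rightarrow> 'a measure \<Rightarrow> real"
  where "wasserstein_dist p \<mu> \<nu> =
    (INF \<pi>\<in>couplings \<mu> \<nu>. (\<integral>z. dist (fst z) (snd z) powr p \<partial>\<pi>) powr (1 / p))"

lemma dist_powr_le:
  fixes x y a b :: "'a::metric_space"
  assumes "p > 0"
  shows "dist x y powr p \<le> 3 powr p * (dist x a powr p + dist y b powr p + dist a b powr p)"
proof -
  define m where "m = max (dist x a) (max (dist y b) (dist a b))"
  have m0: "0 \<le> m" by (simp add: m_def le_max_iff_disj)
  have "dist x y \<le> dist x a + dist a b + dist b y"
    by (meson add_mono_thms_linordered_semiring(3) dist_triangle order_trans)
  then have "dist x y \<le> 3 * m"
    unfolding m_def by (simp add: dist_commute[of b y])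
  then have "dist x y powr p \<le> (3 * m) powr p"
    using assms by (intro powr_mono2) auto
  also have "\<dots> = 3 powr p * m powr p"
    using m0 by (simp add: powr_mult)
  also have "m powr p \<le> dist x a powr p + dist y b powr p + dist a b powr p"
    unfolding m_def max_def by (auto simp: add_nonneg_nonneg)
  finally show ?thesis by simp
qed

lemma integrable_coupling_cost:
  fixes \<mu> \<nu> :: "'a::polish_space measure"
  assumes "p > 0" and \<mu>: "\<mu> \<in> wasserstein_space p" and \<nu>: "\<nu> \<in> wasserstein_space p"
    and \<pi>: "\<pi> \<in> couplings \<mu> \<nu>"
  shows "integrable \<pi> (\<lambda>z. dist (fst z) (snd z) powr p)"
proof -
  obtain a b where a: "integrable \<mu> (\<lambda>y. dist y a powr p)"
    and b: "integrable \<nu> (\<lambda>y. dist y b powr p)"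
    using \<mu> \<nu> by (auto simp: wasserstein_space_def)
  interpret prob_space \<pi> using \<pi> by (simp add: couplings_def)
  have s [measurable_cong]: "sets \<pi> = sets (borel \<Otimes>\<^sub>M borel)"
    using \<pi> unfolding couplings_def borel_prod by simp
  have m: "distr \<pi> borel fst = \<mu>" "distr \<pi> borel snd = \<nu>"
    using \<pi> by (auto simp: couplings_def)
  have 1: "integrable \<pi> (\<lambda>z. dist (fst z) a powr p)"
    using a unfolding m(1)[symmetric] by (subst (asm) integrable_distr_eq) auto
  have 2: "integrable \<pi> (\<lambda>z. dist (snd z) b powr p)"
    using b unfolding m(2)[symmetric] by (subst (asm) integrable_distr_eq) auto
  show ?thesis
  proof (rule Bochner_Integration.integrable_bound)
    show "integrable \<pi> (\<lambda>z. 3 powr p *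
        (dist (fst z) a powr p + dist (snd z) b powr p + dist a b powr p))"
      using 1 2 by (intro integrable_mult_right Bochner_Integration.integrable_add) auto
    show "(\<lambda>z. dist (fst z) (snd z) powr p) \<in> borel_measurable \<pi>"
      by measurable
    show "AE z in \<pi>. norm (dist (fst z) (snd z) powr p) \<le> norm (3 powr p *
        (dist (fst z) a powr p + dist (snd z) b powr p + dist a b powr p))"
      using dist_powr_le[OF \<open>p > 0\<close>] by (intro AE_I2) (simp add: abs_of_nonneg)
  qed
qed

(* For D = \<infinity> the upper bound is vacuous at distinct points; at x = y the ereal
   convention \<infinity> * 0 = 0 turns it into dY (f x) (f x) \<le> 0. *)
definition distortion_at_most ::
    "'a set \<Rightarrow> ('a \<Rightarrow> 'a \<Rightarrow> real) \<Rightarrow> ('b \<Rightarrow> 'b \<Rightarrow> real) \<Rightarrow> ('a \<Rightarrow> 'b) \<Rightarrow> ereal \<Rightarrow> bool"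
  where "distortion_at_most X dX dY f D \<longleftrightarrow>
    (\<exists>s::real. s > 0 \<and> (\<forall>x\<in>X. \<forall>y\<in>X.
        s * dX x y \<le> dY (f x) (f y) \<and> ereal (dY (f x) (f y)) \<le> D * ereal (s * dX x y)))"

definition distortion_inf ::
    "'b set \<Rightarrow> ('b \<Rightarrow> 'b \<Rightarrow> real) \<Rightarrow> 'a set \<Rightarrow> ('a \<Rightarrow> 'a \<Rightarrow> real) \<Rightarrow> ereal"
  where "distortion_inf Y dY X dX =
    Inf {D. 1 \<le> D \<and> (\<exists>f. f \<in> X \<rightarrow> Y \<and> distortion_at_most X dX dY f D)}"

end

theory Submission
  imports Defs
begin

text \<open>
  The spaces \<open>X\<^sub>n\<close> are discrete cubes of dimension \<open>k = 4 t\<close> with the Hamming metric, where \<open>t\<close> is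
  a power of two, and the lower bound comes from comparing how far the simple random walk travels
  in the snowflaked cube and in its image.

  The target space satisfies a star inequality (\<open>sum_transport_cost_le\<close>): if \<open>\<mu>\<^sub>1\<close>, ..., \<open>\<mu>\<^sub>m\<close> and \<open>\<nu>\<close> are
  probability measures with finite \<open>p\<close>-th moments, then the average over \<open>i\<close> and \<open>j\<close> of the \<open>p\<close>-th
  power transport cost between \<open>\<mu>\<^sub>i\<close> and \<open>\<mu>\<^sub>j\<close> is at most \<open>K\<close> times the average over \<open>i\<close> of the cost
  between \<open>\<mu>\<^sub>i\<close> and \<open>\<nu>\<close>, where \<open>K = 2\<close> for \<open>p \<le> 2\<close> and \<open>K = 2\<^sup>p\<^sup>-\<^sup>1\<close> for \<open>p \<ge> 2\<close>. For points of the
  real line in place of measures this is a statement about independent random variables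
  (\<open>sum_powr_differences_le\<close>), which for \<open>p = 2\<close> is an expansion of squares; the Mazur map reduces \<open>p > 2\<close>,
  and the representation of \<open>\<bar>u\<bar>\<^sup>p\<close> as a mixture of the functions \<open>1 - cos (s u)\<close> reduces \<open>p < 2\<close>, to that
  case. It passes to measures because couplings of the \<open>\<mu>\<^sub>i\<close> with \<open>\<nu>\<close> can be glued along \<open>\<nu>\<close>
  (\<open>exists_glued_coupling\<close>), with leaves that are conditionally independent given the centre. To keep
  \<open>K\<close> exact, costs are measured coordinatewise, in the \<open>\<ell>\<^sub>p\<close> norm.

  Two independent walks of length \<open>t\<close> issued from a common point join to a walk of length \<open>2 t\<close>.
  Hence the star inequality shows that doubling the time multiplies the mean \<open>p\<close>-th power
  displacement of the image of the walk by at most \<open>K\<close> (\<open>displacement_double\<close>). Starting from one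
  step, where the displacement is controlled by the upper distortion bound, the displacement after \<open>t\<close>
  steps is at most of order \<open>t\<^sup>1\<^sup>/\<^sup>p\<close> for \<open>p \<le> 2\<close> and of order \<open>t\<^sup>1\<^sup>-\<^sup>1\<^sup>/\<^sup>p\<close> for \<open>p \<ge> 2\<close>, in the
  \<open>p\<close>-th mean. In the cube, however, the walk is at distance of order \<open>t\<close> after \<open>t \<le> k / 4\<close> steps (\<open>mean_card_endpoint_ge\<close>), so in the
  snowflake it is at distance of order \<open>t\<^sup>\<alpha>\<close>. The quotient of the two bounds the distortion from below
  (\<open>snowflake_cube_distortion_ge\<close>), and \<open>t\<close> is comparable to the logarithm of the number \<open>2\<^sup>k\<close> of points.
\<close>

section \<open>Differences of independent random variables\<close>

text \<open>
  Expanding the squares gives the right-hand side minus twice the square of the sum of the means,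
  and the latter is dropped. Summing over all pairs, diagonal included, is what
  makes the cross terms a perfect square. Both exponent ranges below are
  reduced to this case.
\<close>

lemma sum_squared_differences_le:
  fixes h :: "'i \<Rightarrow> 'a \<Rightarrow> real"
  assumes I: "finite I" and M: "\<And>i. i \<in> I \<Longrightarrow> prob_space (M i)"
    and h [measurable]: "\<And>i. i \<in> I \<Longrightarrow> h i \<in> borel_measurable (M i)"
  shows "(\<Sum>i\<in>I. \<Sum>j\<in>I. \<integral>\<^sup>+x. \<integral>\<^sup>+y. ennreal ((h i x - h j y)\<^sup>2) \<partial>M j \<partial>M i)
    \<le> 2 * of_nat (card I) * (\<Sum>i\<in>I. \<integral>\<^sup>+x. ennreal ((h i x)\<^sup>2) \<partial>M i)"
proof (cases "\<exists>i\<in>I. (\<integral>\<^sup>+x. ennreal ((h i x)\<^sup>2) \<partial>M i) = \<infinity>")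
  case True
  then obtain k where k: "k \<in> I" "(\<integral>\<^sup>+x. ennreal ((h k x)\<^sup>2) \<partial>M k) = \<infinity>" by blast
  have "(\<integral>\<^sup>+x. ennreal ((h k x)\<^sup>2) \<partial>M k) \<le> (\<Sum>i\<in>I. \<integral>\<^sup>+x. ennreal ((h i x)\<^sup>2) \<partial>M i)"
    by (rule member_le_sum) (use I k in auto)
  then have "(\<Sum>i\<in>I. \<integral>\<^sup>+x. ennreal ((h i x)\<^sup>2) \<partial>M i) = \<top>"
    using k by (simp add: top_unique)
  moreover have "card I \<noteq> 0" using I k by auto
  ultimately show ?thesis by (simp add: ennreal_mult_top)
next
  case False
  define a where "a i = (\<integral>x. (h i x)\<^sup>2 \<partial>M i)" for i
  define b where "b i = (\<integral>x. h i x \<partial>M i)" for i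
  have sq: "integrable (M i) (\<lambda>x. (h i x)\<^sup>2)" if "i \<in> I" for i
  proof (rule integrableI_nonneg)
    show "(\<integral>\<^sup>+x. ennreal ((h i x)\<^sup>2) \<partial>M i) < \<infinity>"
      using False that by (simp add: less_top)
    show "(\<lambda>x. (h i x)\<^sup>2) \<in> borel_measurable (M i)" using that by measurable
  qed simp
  have lin: "integrable (M i) (h i)" if "i \<in> I" for i
  proof -
    interpret prob_space "M i" by (rule M[OF that])
    show ?thesis by (rule square_integrable_imp_integrable[OF h[OF that] sq[OF that]])
  qed
  have inner: "(\<integral>\<^sup>+y. ennreal ((t - h j y)\<^sup>2) \<partial>M j) = ennreal (t\<^sup>2 + a j - 2 * t * b j)"
    if "j \<in> I" for j t
  proof -
    interpret prob_space "M j" by (rule M[OF that])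
    note [simp] = sq[OF that] lin[OF that]
    have "(\<integral>\<^sup>+y. ennreal ((t - h j y)\<^sup>2) \<partial>M j) = ennreal (\<integral>y. (t - h j y)\<^sup>2 \<partial>M j)"
    proof (rule nn_integral_eq_integral)
      show "integrable (M j) (\<lambda>y. (t - h j y)\<^sup>2)" unfolding power2_diff by simp
    qed simp
    also have "(\<integral>y. (t - h j y)\<^sup>2 \<partial>M j) = t\<^sup>2 + a j - 2 * t * b j"
      by (simp add: power2_diff a_def b_def prob_space)
    finally show ?thesis .
  qed
  have outer: "(\<integral>\<^sup>+x. \<integral>\<^sup>+y. ennreal ((h i x - h j y)\<^sup>2) \<partial>M j \<partial>M i) = ennreal (a i + a j - 2 * b i * b j)"
    and outer_nonneg: "0 \<le> a i + a j - 2 * b i * b j"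
    if "i \<in> I" "j \<in> I" for i j
  proof -
    interpret prob_space "M i" by (rule M[OF that(1)])
    note [simp] = sq[OF that(1)] lin[OF that(1)]
    have nonneg: "0 \<le> t\<^sup>2 + a j - 2 * t * b j" for t
    proof -
      interpret j: prob_space "M j" by (rule M[OF that(2)])
      have "0 \<le> (\<integral>y. (t - h j y)\<^sup>2 \<partial>M j)" by simp
      also have "\<dots> = t\<^sup>2 + a j - 2 * t * b j"
        using sq[OF that(2)] lin[OF that(2)] by (simp add: power2_diff a_def b_def j.prob_space)
      finally show ?thesis .
    qed
    have eq: "(\<integral>x. (h i x)\<^sup>2 + a j - 2 * h i x * b j \<partial>M i) = a i + a j - 2 * b i * b j"
      by (simp add: a_def b_def prob_space)
    have "0 \<le> (\<integral>x. (h i x)\<^sup>2 + a j - 2 * h i x * b j \<partial>M i)"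
      by (rule Bochner_Integration.integral_nonneg) (rule nonneg)
    then show "0 \<le> a i + a j - 2 * b i * b j" by (simp only: eq)
    show "(\<integral>\<^sup>+x. \<integral>\<^sup>+y. ennreal ((h i x - h j y)\<^sup>2) \<partial>M j \<partial>M i) = ennreal (a i + a j - 2 * b i * b j)"
      unfolding inner[OF that(2)] eq[symmetric]
    proof (rule nn_integral_eq_integral)
      show "AE x in M i. 0 \<le> (h i x)\<^sup>2 + a j - 2 * h i x * b j" by (rule AE_I2) (rule nonneg)
    qed simp
  qed
  have "(\<Sum>i\<in>I. \<Sum>j\<in>I. \<integral>\<^sup>+x. \<integral>\<^sup>+y. ennreal ((h i x - h j y)\<^sup>2) \<partial>M j \<partial>M i)
      = (\<Sum>i\<in>I. \<Sum>j\<in>I. ennreal (a i + a j - 2 * b i * b j))"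
    by (intro sum.cong refl outer)
  also have "\<dots> = (\<Sum>i\<in>I. ennreal (\<Sum>j\<in>I. a i + a j - 2 * b i * b j))"
    by (intro sum.cong refl sum_ennreal outer_nonneg)
  also have "\<dots> = ennreal (\<Sum>i\<in>I. \<Sum>j\<in>I. a i + a j - 2 * b i * b j)"
    by (intro sum_ennreal sum_nonneg outer_nonneg)
  also have "(\<Sum>i\<in>I. \<Sum>j\<in>I. a i + a j - 2 * b i * b j) = 2 * card I * (\<Sum>i\<in>I. a i) - 2 * (\<Sum>i\<in>I. b i)\<^sup>2"
    by (simp add: sum.distrib sum_subtractf power2_eq_square sum_product sum_distrib_left
        sum_distrib_right algebra_simps)
  also have "\<dots> \<le> 2 * card I * (\<Sum>i\<in>I. a i)" by simp
  also have "ennreal (2 * card I * (\<Sum>i\<in>I. a i))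
     = 2 * of_nat (card I) * (\<Sum>i\<in>I. ennreal (a i))"
    by (subst sum_ennreal) (auto simp: a_def ennreal_mult sum_nonneg ennreal_of_nat_eq_real_of_nat)
  also have "(\<Sum>i\<in>I. ennreal (a i)) = (\<Sum>i\<in>I. \<integral>\<^sup>+x. ennreal ((h i x)\<^sup>2) \<partial>M i)"
    unfolding a_def by (intro sum.cong refl nn_integral_eq_integral[symmetric] sq) auto
  finally show ?thesis by (simp add: ennreal_leI)
qed

text \<open>
  Dividing by \<^term>\<open>x + y\<close> reduces this to \<^prop>\<open>z powr q \<le> z\<close> on the unit interval.
\<close>

lemma add_powr_le_powr_add:
  fixes x y q :: real
  assumes "0 \<le> x" "0 \<le> y" "1 \<le> q"
  shows "x powr q + y powr q \<le> (x + y) powr q"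
proof (cases "x + y = 0")
  case False
  then have s: "x + y > 0" using assms by simp
  have "(z / (x + y)) powr q \<le> z / (x + y)" if "0 \<le> z" "z \<le> x + y" for z
    using powr_mono'[of 1 q "z / (x + y)"] that s assms by simp
  from this[of x] this[of y] have "(x / (x+y)) powr q + (y / (x+y)) powr q \<le> x / (x+y) + y / (x+y)"
    using assms by simp
  also have "\<dots> = 1" using s by (simp flip: add_divide_distrib)
  finally show ?thesis using assms s by (simp add: powr_divide divide_simps flip: add_divide_distrib)
qed (use assms in \<open>simp add: add_nonneg_eq_0_iff\<close>)

lemma add_powr_le_two_powr_mult:
  fixes x y q :: real
  assumes "0 \<le> x" "0 \<le> y" "1 \<le> q"
  shows "(x + y) powr q \<le> 2 powr (q - 1) * (x powr q + y powr q)"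
proof (cases "x = 0 \<or> y = 0")
  case True
  have "1 * (x powr q + y powr q) \<le> 2 powr (q - 1) * (x powr q + y powr q)"
    using assms by (intro mult_right_mono ge_one_powr_ge_zero) auto
  then show ?thesis using True by auto
next
  case False
  then have "((1 - 1/2) *\<^sub>R x + (1/2) *\<^sub>R y) powr q \<le> (1 - 1/2) * x powr q + (1/2) * y powr q"
    using assms by (intro convex_onD[OF powr_convex[of q]]) auto
  then have "((x + y) / 2) powr q \<le> (x powr q + y powr q) / 2" by (simp add: field_simps)
  then show ?thesis using assms by (simp add: powr_divide powr_diff divide_simps mult.commute)
qed

text \<open>
  The Mazur map, which carries the unit sphere of \<open>L\<^sub>2\<^sub>q\<close> onto that of \<open>L\<^sub>2\<close> when applied to values.
\<close>

definition mazur :: "real \<Rightarrow> real \<Rightarrow> real"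
  where "mazur q a = sgn a * \<bar>a\<bar> powr q"

text \<open>
  For opposite signs this is convexity of the power function, for equal signs it is
  superadditivity. The constant is attained at \<open>b = - a\<close>; any larger one would be compounded at
  every doubling step later on.
\<close>

lemma abs_diff_powr_le_mazur:
  assumes "1 \<le> q"
  shows "\<bar>a - b\<bar> powr (2 * q) \<le> 2 powr (2 * q - 2) * (mazur q a - mazur q b)\<^sup>2"
proof -
  have root: "\<bar>a - b\<bar> powr q \<le> 2 powr (q - 1) * \<bar>mazur q a - mazur q b\<bar>"
  proof (cases "a * b < 0")
    case True
    have opposite: "\<bar>mazur q x - mazur q y\<bar> = \<bar>x\<bar> powr q + \<bar>y\<bar> powr q" if "x > 0" "y < 0" for x y
      using that by (simp add: mazur_def abs_of_nonneg)
    have "\<bar>a - b\<bar> = \<bar>a\<bar> + \<bar>b\<bar>"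
      and "\<bar>mazur q a - mazur q b\<bar> = \<bar>a\<bar> powr q + \<bar>b\<bar> powr q"
      using True opposite[of a b] opposite[of b a]
      by (auto simp: mult_less_0_iff abs_minus_commute)
    then show ?thesis using add_powr_le_two_powr_mult[of "\<bar>a\<bar>" "\<bar>b\<bar>" q] assms by simp
  next
    case False
    have le: "\<bar>x - y\<bar> powr q \<le> \<bar>x powr q - y powr q\<bar>" if "0 \<le> x" "0 \<le> y" for x y :: real
      using that
    proof (induction x y rule: linorder_wlog)
      case (le x y)
      then show ?case using add_powr_le_powr_add[of x "y - x" q] assms by (simp add: abs_if)
    qed (simp add: abs_minus_commute)
    have "\<bar>a - b\<bar> = \<bar>\<bar>a\<bar> - \<bar>b\<bar>\<bar>"
      and "\<bar>mazur q a - mazur q b\<bar> = \<bar>\<bar>a\<bar> powr q - \<bar>b\<bar> powr q\<bar>"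
      using False by (auto simp: mazur_def sgn_if mult_less_0_iff abs_if split: if_splits)
    then have "\<bar>a - b\<bar> powr q \<le> 1 * \<bar>mazur q a - mazur q b\<bar>" using le[of "\<bar>a\<bar>" "\<bar>b\<bar>"] by simp
    also have "\<dots> \<le> 2 powr (q - 1) * \<bar>mazur q a - mazur q b\<bar>"
      using assms by (intro mult_right_mono ge_one_powr_ge_zero) auto
    finally show ?thesis .
  qed
  have "\<bar>a - b\<bar> powr (2 * q) = (\<bar>a - b\<bar> powr q)\<^sup>2"
    by (simp add: powr_powr mult.commute flip: powr_numeral)
  also have "\<dots> \<le> (2 powr (q - 1) * \<bar>mazur q a - mazur q b\<bar>)\<^sup>2"
    using root by (intro power_mono) auto
  also have "\<dots> = 2 powr (2 * q - 2) * (mazur q a - mazur q b)\<^sup>2"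
    by (simp add: power_mult_distrib powr_power algebra_simps)
  finally show ?thesis .
qed

lemma mazur_squared: "(mazur q a)\<^sup>2 = \<bar>a\<bar> powr (2 * q)"
  by (cases "a = 0") (auto simp: mazur_def power_mult_distrib powr_power mult.commute sgn_if)

text \<open>
  The density, on the positive half-line, of the Levy measure of a symmetric \<open>p\<close>-stable law.
\<close>

definition cos_weight :: "real \<Rightarrow> real \<Rightarrow> real"
  where "cos_weight p s = indicator {0<..} s * s powr (- 1 - p)"

lemma cos_weight_nonneg: "0 \<le> cos_weight p s"
  by (simp add: cos_weight_def)

lemma cos_weight_measurable [measurable]: "cos_weight p \<in> borel_measurable borel"
  unfolding cos_weight_def by measurable

text \<open>
  Near zero the quadratic vanishing of \<open>1 - cos s\<close> beats the singularity because \<open>p < 2\<close>; at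
  infinity the weight is integrable because \<open>p > 0\<close>.
\<close>

lemma one_minus_cos_nn_integral_finite:
  assumes "0 < p" "p < 2"
  shows "(\<integral>\<^sup>+s. ennreal ((1 - cos s) * cos_weight p s) \<partial>lborel) < \<infinity>"
proof -
  let ?f = "\<lambda>s. indicator {0..1} s * s powr (1 - p) :: real"
  let ?g = "\<lambda>s. indicator {1..} s * s powr (- 1 - p) :: real"
  have bd: "(1 - cos s) * cos_weight p s \<le> ?f s + 2 * ?g s" for s
  proof -
    have "1 - cos s = 2 * \<bar>sin (s / 2)\<bar>\<^sup>2" using cos_double_sin[of "s / 2"] by simp
    also have "\<dots> \<le> 2 * \<bar>s / 2\<bar>\<^sup>2" by (intro mult_left_mono power_mono abs_sin_x_le_abs_x) auto
    finally have "1 - cos s \<le> s\<^sup>2 / 2" by (simp add: power_divide)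
    then have "1 - cos s \<le> s\<^sup>2" using zero_le_power2[of s] by linarith
    moreover have "s\<^sup>2 * s powr (-1-p) = s powr (1 - p)" if "s > 0"
      using that by (simp flip: powr_numeral powr_add)
    moreover have "1 - cos s \<le> 2" using cos_ge_minus_one[of s] by simp
    moreover have "0 \<le> s powr (-1-p)" by simp
    ultimately show ?thesis
      using mult_right_mono[of "1 - cos s" "s\<^sup>2" "s powr (-1-p)"]
        mult_right_mono[of "1 - cos s" 2 "s powr (-1-p)"]
      by (auto simp: cos_weight_def indicator_def intro: add_increasing2)
  qed
  have restrict: "(\<lambda>s. indicator S s * f s) = (\<lambda>s. if s \<in> S then f s else 0)"
    for S and f :: "real \<Rightarrow> real" by (auto simp: indicator_def)
  have "(?f has_integral (1 powr (1 - p + 1) / (1 - p + 1))) UNIV"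
    using has_integral_powr_from_0[of "1 - p" 1] assms
    unfolding restrict has_integral_restrict_UNIV by simp
  then have 1: "(\<integral>\<^sup>+s. ennreal (?f s) \<partial>lborel) < \<infinity>"
    by (subst nn_integral_has_integral_lborel) auto
  have "(?g has_integral (- (1 powr (- 1 - p + 1)) / (- 1 - p + 1))) UNIV"
    using has_integral_powr_to_inf[of "- 1 - p" 1] assms
    unfolding restrict has_integral_restrict_UNIV by simp
  then have 2: "(\<integral>\<^sup>+s. ennreal (?g s) \<partial>lborel) < \<infinity>"
    by (subst nn_integral_has_integral_lborel) auto
  have "(\<integral>\<^sup>+s. ennreal ((1 - cos s) * cos_weight p s) \<partial>lborel)
      \<le> (\<integral>\<^sup>+s. ennreal (?f s) + 2 * ennreal (?g s) \<partial>lborel)"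
    using bd by (intro nn_integral_mono) (simp add: ennreal_leI flip: ennreal_plus ennreal_mult'' ennreal_numeral)
  also have "\<dots> = (\<integral>\<^sup>+s. ennreal (?f s) \<partial>lborel) + 2 * (\<integral>\<^sup>+s. ennreal (?g s) \<partial>lborel)"
    by (simp add: nn_integral_add nn_integral_cmult)
  also have "\<dots> < \<infinity>" using 1 2 by (simp add: ennreal_mult_less_top)
  finally show ?thesis .
qed

lemma one_minus_cos_nn_integral_pos:
  "0 < (\<integral>\<^sup>+s. ennreal ((1 - cos s) * cos_weight p s) \<partial>lborel)"
proof (rule ccontr)
  assume "\<not> ?thesis"
  then have "AE s in lborel. (1 - cos s) * cos_weight p s \<le> 0"
    by (subst (asm) not_gr_zero, subst (asm) nn_integral_0_iff_AE) (auto simp: ennreal_eq_0_iff)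
  then have "AE s in lborel. s \<notin> {1<..<2::real}"
  proof eventually_elim
    case (elim s)
    show ?case
    proof
      assume s: "s \<in> {1<..<2}"
      then have "cos s < cos 0" using pi_ge_two by (intro cos_monotone_0_pi) auto
      then have "0 < (1 - cos s) * cos_weight p s" using s by (simp add: cos_weight_def)
      with elim show False by simp
    qed
  qed
  then have "emeasure lborel {1<..<2::real} = 0"
    by (subst (asm) AE_iff_measurable[of "{1<..<2}"]) auto
  then show False by simp
qed

text \<open>
  Schoenberg's formula: up to a constant factor, \<open>\<bar>u\<bar>\<^sup>p\<close> is a mixture of the functions
  \<open>1 - cos (s u)\<close>. It is the substitution \<open>s \<mapsto> \<bar>u\<bar> s\<close>.
\<close>

lemma nn_integral_one_minus_cos_scaled:
  assumes "0 < p"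
  shows "(\<integral>\<^sup>+s. ennreal ((1 - cos (s * u)) * cos_weight p s) \<partial>lborel)
    = ennreal (\<bar>u\<bar> powr p) * (\<integral>\<^sup>+s. ennreal ((1 - cos s) * cos_weight p s) \<partial>lborel)"
proof (cases "u = 0")
  case False
  let ?J = "\<lambda>u. \<integral>\<^sup>+s. ennreal ((1 - cos (s * u)) * cos_weight p s) \<partial>lborel"
  have "?J 1 = \<bar>\<bar>u\<bar>\<bar> * (\<integral>\<^sup>+s. ennreal ((1 - cos ((0 + \<bar>u\<bar> * s) * 1)) * cos_weight p (0 + \<bar>u\<bar> * s)) \<partial>lborel)"
    using False by (intro nn_integral_real_affine) auto
  also have "\<dots> = ennreal \<bar>u\<bar> * (\<integral>\<^sup>+s. ennreal (\<bar>u\<bar> powr (-1-p)) * ennreal ((1 - cos (s * u)) * cos_weight p s) \<partial>lborel)"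
  proof -
    have "cos (\<bar>u\<bar> * s) = cos (s * u)" for s by (auto simp: abs_if mult.commute)
    moreover have "cos_weight p (\<bar>u\<bar> * s) = \<bar>u\<bar> powr (-1-p) * cos_weight p s" for s
      using False by (auto simp: cos_weight_def powr_mult indicator_def zero_less_mult_iff)
    ultimately show ?thesis
      by (simp add: cos_weight_nonneg mult_ac flip: ennreal_mult'')
  qed
  also have "\<dots> = ennreal (\<bar>u\<bar> * \<bar>u\<bar> powr (-1-p)) * ?J u"
    by (subst nn_integral_cmult) (auto simp: ennreal_mult mult_ac)
  also have "\<bar>u\<bar> * \<bar>u\<bar> powr (-1-p) = \<bar>u\<bar> powr (- p)"
    using False powr_add[of "\<bar>u\<bar>" 1 "-1-p"] by simp
  finally have "ennreal (\<bar>u\<bar> powr p) * ?J 1 = ennreal (\<bar>u\<bar> powr p * \<bar>u\<bar> powr (- p)) * ?J u"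
    by (simp add: ennreal_mult mult_ac)
  also have "\<bar>u\<bar> powr p * \<bar>u\<bar> powr (- p) = 1" using False by (simp flip: powr_add)
  finally show ?thesis by simp
qed (use assms in simp)

text \<open>
  Half the squared distance of two points of the unit circle, taken relative to the point \<open>1\<close>.
  The shift by one makes the corresponding norms equal to \<open>1 - cos\<close> again, see the next lemma.
\<close>

lemma one_minus_cos_diff_eq_squares:
  "1 - cos (x - y) = (((cos x - 1) - (cos y - 1))\<^sup>2 + (sin x - sin y)\<^sup>2) / 2" for x y :: real
  by (simp add: cos_diff power2_diff sin_squared_eq)

lemma sum_one_minus_cos_differences_le:
  fixes h :: "'i \<Rightarrow> 'a \<Rightarrow> real"
  assumes I: "finite I" and M: "\<And>i. i \<in> I \<Longrightarrow> prob_space (M i)"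
    and h [measurable]: "\<And>i. i \<in> I \<Longrightarrow> h i \<in> borel_measurable (M i)"
  shows "(\<Sum>i\<in>I. \<Sum>j\<in>I. \<integral>\<^sup>+x. \<integral>\<^sup>+y. ennreal (1 - cos (h i x - h j y)) \<partial>M j \<partial>M i)
    \<le> 2 * of_nat (card I) * (\<Sum>i\<in>I. \<integral>\<^sup>+x. ennreal (1 - cos (h i x)) \<partial>M i)"
proof -
  have halve: "ennreal ((u + v) / 2) = (1/2) * (ennreal u + ennreal v)" if "0 \<le> u" "0 \<le> v" for u v
    using that by (simp add: divide_ennreal[symmetric] ennreal_times_divide mult.commute)
  have sm: "h i \<in> borel_measurable (M i)" if "i \<in> I" for i using that by simp
  define A where "A i j = (\<integral>\<^sup>+x. \<integral>\<^sup>+y. ennreal (((cos (h i x) - 1) - (cos (h j y) - 1))\<^sup>2) \<partial>M j \<partial>M i)" for i j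
  define B where "B i j = (\<integral>\<^sup>+x. \<integral>\<^sup>+y. ennreal ((sin (h i x) - sin (h j y))\<^sup>2) \<partial>M j \<partial>M i)" for i j
  define a where "a i = (\<integral>\<^sup>+x. ennreal ((cos (h i x) - 1)\<^sup>2) \<partial>M i)" for i
  define b where "b i = (\<integral>\<^sup>+x. ennreal ((sin (h i x))\<^sup>2) \<partial>M i)" for i
  have 1: "(\<integral>\<^sup>+x. \<integral>\<^sup>+y. ennreal (1 - cos (h i x - h j y)) \<partial>M j \<partial>M i) = (1/2) * (A i j + B i j)"
    if "i \<in> I" "j \<in> I" for i j
  proof -
    interpret j: prob_space "M j" by (rule M[OF that(2)])
    note [measurable] = sm[OF that(1)] sm[OF that(2)]
    show ?thesis
      unfolding A_def B_def one_minus_cos_diff_eq_squares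
      by (simp add: halve nn_integral_cmult nn_integral_add)
  qed
  have 2: "(\<integral>\<^sup>+x. ennreal (1 - cos (h i x)) \<partial>M i) = (1/2) * (a i + b i)" if "i \<in> I" for i
  proof -
    note [measurable] = sm[OF that(1)]
    have eq: "1 - cos t = ((cos t - 1)\<^sup>2 + (sin t)\<^sup>2) / 2" for t :: real
      using one_minus_cos_diff_eq_squares[of t 0] by simp
    show ?thesis
      unfolding a_def b_def eq by (simp add: halve nn_integral_cmult nn_integral_add)
  qed
  have "(\<Sum>i\<in>I. \<Sum>j\<in>I. A i j) \<le> 2 * of_nat (card I) * (\<Sum>i\<in>I. a i)"
    unfolding A_def a_def using sm by (intro sum_squared_differences_le I M) measurable
  moreover have "(\<Sum>i\<in>I. \<Sum>j\<in>I. B i j) \<le> 2 * of_nat (card I) * (\<Sum>i\<in>I. b i)"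
    unfolding B_def b_def using sm by (intro sum_squared_differences_le I M) measurable
  ultimately have le: "(1/2) * ((\<Sum>i\<in>I. \<Sum>j\<in>I. A i j) + (\<Sum>i\<in>I. \<Sum>j\<in>I. B i j))
      \<le> (1/2) * (2 * of_nat (card I) * (\<Sum>i\<in>I. a i) + 2 * of_nat (card I) * (\<Sum>i\<in>I. b i))"
    by (intro mult_left_mono add_mono) auto
  have lhs: "(\<Sum>i\<in>I. \<Sum>j\<in>I. \<integral>\<^sup>+x. \<integral>\<^sup>+y. ennreal (1 - cos (h i x - h j y)) \<partial>M j \<partial>M i)
      = (1/2) * ((\<Sum>i\<in>I. \<Sum>j\<in>I. A i j) + (\<Sum>i\<in>I. \<Sum>j\<in>I. B i j))"
    by (simp add: 1 sum.distrib sum_distrib_left distrib_left cong: sum.cong)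
  have half: "(\<Sum>i\<in>I. (1/2) * (a i + b i)) = (1/2) * ((\<Sum>i\<in>I. a i) + (\<Sum>i\<in>I. b i))"
    by (simp only: sum.distrib sum_distrib_left[symmetric])
  have rhs: "(1/2) * (2 * of_nat (card I) * (\<Sum>i\<in>I. a i) + 2 * of_nat (card I) * (\<Sum>i\<in>I. b i))
     = 2 * of_nat (card I) * (\<Sum>i\<in>I. (1/2) * (a i + b i))"
    unfolding half by (simp only: distrib_left mult_ac)
  have "(\<Sum>i\<in>I. \<integral>\<^sup>+x. ennreal (1 - cos (h i x)) \<partial>M i) = (\<Sum>i\<in>I. (1/2) * (a i + b i))"
    by (intro sum.cong refl 2)
  with le show ?thesis by (simp only: lhs rhs)
qed

text \<open>
  Equal to \<open>2\<close> for \<open>p \<le> 2\<close> and to \<open>2\<^sup>p\<^sup>-\<^sup>1\<close> for \<open>p \<ge> 2\<close>, so that its \<open>p\<close>-th root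
  interpolates between the orthogonality constant at \<open>p = 2\<close> and the triangle inequality at \<open>p = \<infinity>\<close>. Its \<open>j\<close>-th power
  is \<open>t\<^sup>m\<close> with \<open>t = 2\<^sup>j\<close> and \<open>m = max 1 (p - 1)\<close>, which is where the final exponent comes from.
\<close>

definition star_const :: "real \<Rightarrow> real"
  where "star_const p = 2 powr max 1 (p - 1)"

text \<open>
  For independent \<open>A\<close>, \<open>B\<close> distributed as the mixture of the laws of the \<open>g i\<close>, this says
  that the \<open>p\<close>-th moment of \<open>A - B\<close> is at most \<^term>\<open>star_const p\<close> times that of \<open>A - c\<close>. For \<open>p \<ge> 2\<close> the Mazur map turns \<open>p\<close>-th powers into
  squares; for \<open>p < 2\<close> the oscillation formula writes them as mixtures of squares.
\<close>

lemma sum_powr_differences_le: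
  fixes g :: "'i \<Rightarrow> 'a \<Rightarrow> real"
  assumes I: "finite I" and M: "\<And>i. i \<in> I \<Longrightarrow> prob_space (M i)"
    and g [measurable]: "\<And>i. i \<in> I \<Longrightarrow> g i \<in> borel_measurable (M i)"
    and p: "1 < p"
  shows "(\<Sum>i\<in>I. \<Sum>j\<in>I. \<integral>\<^sup>+x. \<integral>\<^sup>+y. ennreal (\<bar>g i x - g j y\<bar> powr p) \<partial>M j \<partial>M i)
    \<le> ennreal (star_const p) * of_nat (card I) * (\<Sum>i\<in>I. \<integral>\<^sup>+x. ennreal (\<bar>g i x - c\<bar> powr p) \<partial>M i)"
proof (cases "p < 2")
  case False
  define q where "q = p / 2"
  have q: "1 \<le> q" "p = 2 * q" using False by (auto simp: q_def)
  let ?h = "\<lambda>i x. mazur q (g i x - c)"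
  have [measurable]: "mazur q \<in> borel_measurable borel"
    unfolding mazur_def by measurable
  have hm: "?h i \<in> borel_measurable (M i)" if "i \<in> I" for i
    using g[OF that] by measurable
  have "(\<integral>\<^sup>+x. \<integral>\<^sup>+y. ennreal (\<bar>g i x - g j y\<bar> powr p) \<partial>M j \<partial>M i)
      \<le> ennreal (2 powr (p - 2)) * (\<integral>\<^sup>+x. \<integral>\<^sup>+y. ennreal ((?h i x - ?h j y)\<^sup>2) \<partial>M j \<partial>M i)"
    (is "?L i j \<le> _ * ?R i j") if "i \<in> I" "j \<in> I" for i j
  proof -
    interpret j: prob_space "M j" by (rule M[OF that(2)])
    note [measurable] = hm[OF that(1)] hm[OF that(2)]
    have "\<bar>a - b\<bar> powr p \<le> 2 powr (p - 2) * (mazur q (a - c) - mazur q (b - c))\<^sup>2" for a b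
      using abs_diff_powr_le_mazur[OF q(1), of "a - c" "b - c"] by (simp add: q(2))
    then have "?L i j \<le> (\<integral>\<^sup>+x. \<integral>\<^sup>+y. ennreal (2 powr (p - 2)) * ennreal ((?h i x - ?h j y)\<^sup>2) \<partial>M j \<partial>M i)"
      by (intro nn_integral_mono) (simp add: ennreal_leI flip: ennreal_mult)
    then show ?thesis by (simp add: nn_integral_cmult)
  qed
  then have "(\<Sum>i\<in>I. \<Sum>j\<in>I. ?L i j) \<le> (\<Sum>i\<in>I. \<Sum>j\<in>I. ennreal (2 powr (p - 2)) * ?R i j)"
    by (intro sum_mono)
  also have "\<dots> = ennreal (2 powr (p - 2)) * (\<Sum>i\<in>I. \<Sum>j\<in>I. ?R i j)"
    by (simp add: sum_distrib_left)
  also have "\<dots> \<le> ennreal (2 powr (p - 2)) * (2 * of_nat (card I) * (\<Sum>i\<in>I. \<integral>\<^sup>+x. ennreal ((?h i x)\<^sup>2) \<partial>M i))"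
    using hm by (intro mult_left_mono sum_squared_differences_le I M) auto
  also have "\<dots> = ennreal (2 powr (p - 2) * 2) * of_nat (card I) * (\<Sum>i\<in>I. \<integral>\<^sup>+x. ennreal (\<bar>g i x - c\<bar> powr p) \<partial>M i)"
    by (simp add: mazur_squared q(2) ennreal_mult mult_ac)
  also have "2 powr (p - 2) * 2 = star_const p"
    using False powr_add[of 2 "p - 2" 1] by (simp add: star_const_def max_def)
  finally show ?thesis .
next
  case True
  define C where "C = (\<integral>\<^sup>+s. ennreal ((1 - cos s) * cos_weight p s) \<partial>lborel)"
  have C: "0 < C" "C < \<infinity>"
    using one_minus_cos_nn_integral_pos one_minus_cos_nn_integral_finite p True by (auto simp: C_def)
  define e where "e i x = g i x - c" for i x
  have em: "e i \<in> borel_measurable (M i)" if "i \<in> I" for i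
    using g[OF that] unfolding e_def by measurable
  have osc: "C * ennreal (\<bar>u\<bar> powr p) = (\<integral>\<^sup>+s. ennreal (cos_weight p s) * ennreal (1 - cos (s * u)) \<partial>lborel)" for u
    using nn_integral_one_minus_cos_scaled[of p u] p
    by (simp add: C_def mult.commute cos_weight_nonneg flip: ennreal_mult'')
  let ?P = "\<lambda>i j s. \<integral>\<^sup>+x. \<integral>\<^sup>+y. ennreal (1 - cos (s * e i x - s * e j y)) \<partial>M j \<partial>M i"
  let ?Q = "\<lambda>i s. \<integral>\<^sup>+x. ennreal (1 - cos (s * e i x)) \<partial>M i"
  have L: "C * (\<integral>\<^sup>+x. \<integral>\<^sup>+y. ennreal (\<bar>g i x - g j y\<bar> powr p) \<partial>M j \<partial>M i)
      = (\<integral>\<^sup>+s. ennreal (cos_weight p s) * ?P i j s \<partial>lborel)"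
    and Pm: "?P i j \<in> borel_measurable borel"
    if "i \<in> I" "j \<in> I" for i j
  proof -
    interpret i: prob_space "M i" by (rule M[OF that(1)])
    interpret j: prob_space "M j" by (rule M[OF that(2)])
    interpret li: pair_sigma_finite lborel "M i" ..
    interpret lj: pair_sigma_finite lborel "M j" ..
    note [measurable] = em[OF that(1)] em[OF that(2)]
    have [measurable]: "g i \<in> borel_measurable (M i)" "g j \<in> borel_measurable (M j)"
      using that by auto
    show "?P i j \<in> borel_measurable borel" by measurable
    have "C * (\<integral>\<^sup>+x. \<integral>\<^sup>+y. ennreal (\<bar>g i x - g j y\<bar> powr p) \<partial>M j \<partial>M i)
      = (\<integral>\<^sup>+x. \<integral>\<^sup>+y. C * ennreal (\<bar>e i x - e j y\<bar> powr p) \<partial>M j \<partial>M i)"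
      by (simp add: nn_integral_cmult e_def)
    also have "\<dots> = (\<integral>\<^sup>+x. \<integral>\<^sup>+y. \<integral>\<^sup>+s. ennreal (cos_weight p s) * ennreal (1 - cos (s * e i x - s * e j y)) \<partial>lborel \<partial>M j \<partial>M i)"
      by (simp add: osc right_diff_distrib)
    also have "\<dots> = (\<integral>\<^sup>+x. \<integral>\<^sup>+s. \<integral>\<^sup>+y. ennreal (cos_weight p s) * ennreal (1 - cos (s * e i x - s * e j y)) \<partial>M j \<partial>lborel \<partial>M i)"
      by (intro nn_integral_cong lj.Fubini') measurable
    also have "\<dots> = (\<integral>\<^sup>+s. \<integral>\<^sup>+x. \<integral>\<^sup>+y. ennreal (cos_weight p s) * ennreal (1 - cos (s * e i x - s * e j y)) \<partial>M j \<partial>M i \<partial>lborel)"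
      by (intro li.Fubini') measurable
    finally show "C * (\<integral>\<^sup>+x. \<integral>\<^sup>+y. ennreal (\<bar>g i x - g j y\<bar> powr p) \<partial>M j \<partial>M i)
      = (\<integral>\<^sup>+s. ennreal (cos_weight p s) * ?P i j s \<partial>lborel)"
      by (simp add: nn_integral_cmult)
  qed
  have R: "C * (\<integral>\<^sup>+x. ennreal (\<bar>g i x - c\<bar> powr p) \<partial>M i)
      = (\<integral>\<^sup>+s. ennreal (cos_weight p s) * ?Q i s \<partial>lborel)"
    and Qm: "?Q i \<in> borel_measurable borel"
    if "i \<in> I" for i
  proof -
    interpret i: prob_space "M i" by (rule M[OF that])
    interpret li: pair_sigma_finite lborel "M i" ..
    note [measurable] = em[OF that]
    show "?Q i \<in> borel_measurable borel" by measurable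
    have "C * (\<integral>\<^sup>+x. ennreal (\<bar>g i x - c\<bar> powr p) \<partial>M i) = (\<integral>\<^sup>+x. C * ennreal (\<bar>e i x\<bar> powr p) \<partial>M i)"
      by (simp add: nn_integral_cmult e_def[symmetric])
    also have "\<dots> = (\<integral>\<^sup>+x. \<integral>\<^sup>+s. ennreal (cos_weight p s) * ennreal (1 - cos (s * e i x)) \<partial>lborel \<partial>M i)"
      by (simp add: osc)
    also have "\<dots> = (\<integral>\<^sup>+s. \<integral>\<^sup>+x. ennreal (cos_weight p s) * ennreal (1 - cos (s * e i x)) \<partial>M i \<partial>lborel)"
      by (intro li.Fubini') measurable
    finally show "C * (\<integral>\<^sup>+x. ennreal (\<bar>g i x - c\<bar> powr p) \<partial>M i)
      = (\<integral>\<^sup>+s. ennreal (cos_weight p s) * ?Q i s \<partial>lborel)"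
      by (simp add: nn_integral_cmult)
  qed
  have "C * (\<Sum>i\<in>I. \<Sum>j\<in>I. \<integral>\<^sup>+x. \<integral>\<^sup>+y. ennreal (\<bar>g i x - g j y\<bar> powr p) \<partial>M j \<partial>M i)
      = (\<Sum>i\<in>I. \<Sum>j\<in>I. \<integral>\<^sup>+s. ennreal (cos_weight p s) * ?P i j s \<partial>lborel)"
    by (simp add: sum_distrib_left L cong: sum.cong)
  also have "\<dots> = (\<integral>\<^sup>+s. (\<Sum>i\<in>I. \<Sum>j\<in>I. ennreal (cos_weight p s) * ?P i j s) \<partial>lborel)"
    using Pm by (simp add: nn_integral_sum borel_measurable_sum)
  also have "\<dots> = (\<integral>\<^sup>+s. ennreal (cos_weight p s) * (\<Sum>i\<in>I. \<Sum>j\<in>I. ?P i j s) \<partial>lborel)"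
    by (simp add: sum_distrib_left)
  also have "\<dots> \<le> (\<integral>\<^sup>+s. ennreal (cos_weight p s) * (2 * of_nat (card I) * (\<Sum>i\<in>I. ?Q i s)) \<partial>lborel)"
    using em by (intro nn_integral_mono mult_left_mono sum_one_minus_cos_differences_le I M) auto
  also have "\<dots> = (\<integral>\<^sup>+s. 2 * of_nat (card I) * (\<Sum>i\<in>I. ennreal (cos_weight p s) * ?Q i s) \<partial>lborel)"
    by (simp add: sum_distrib_left mult_ac)
  also have "\<dots> = 2 * of_nat (card I) * (\<integral>\<^sup>+s. (\<Sum>i\<in>I. ennreal (cos_weight p s) * ?Q i s) \<partial>lborel)"
    using Qm by (intro nn_integral_cmult borel_measurable_sum) auto
  also have "\<dots> = 2 * of_nat (card I) * (\<Sum>i\<in>I. C * (\<integral>\<^sup>+x. ennreal (\<bar>g i x - c\<bar> powr p) \<partial>M i))"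
    using Qm by (subst nn_integral_sum) (auto simp: R)
  also have "\<dots> = C * (2 * of_nat (card I) * (\<Sum>i\<in>I. \<integral>\<^sup>+x. ennreal (\<bar>g i x - c\<bar> powr p) \<partial>M i))"
    by (simp add: sum_distrib_left mult_ac)
  finally have "(\<Sum>i\<in>I. \<Sum>j\<in>I. \<integral>\<^sup>+x. \<integral>\<^sup>+y. ennreal (\<bar>g i x - g j y\<bar> powr p) \<partial>M j \<partial>M i)
      \<le> 2 * of_nat (card I) * (\<Sum>i\<in>I. \<integral>\<^sup>+x. ennreal (\<bar>g i x - c\<bar> powr p) \<partial>M i)"
    using C by (simp add: ennreal_mult_le_mult_iff)
  moreover have "star_const p = 2" using True by (simp add: star_const_def max_def)
  ultimately show ?thesis by simp
qed

section \<open>Coordinatewise transport cost\<close>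

text \<open>
  The \<open>p\<close>-th power of the \<open>\<ell>\<^sub>p\<close> distance. Splitting into coordinates lets the real-valued
  inequality be applied with its exact constant; the comparison with the Euclidean metric is made
  only once, so that its loss is not iterated.
\<close>

definition coord_cost :: "real \<Rightarrow> real ^ 'n \<Rightarrow> real ^ 'n \<Rightarrow> real"
  where "coord_cost p x y = (\<Sum>k\<in>UNIV. \<bar>x $ k - y $ k\<bar> powr p)"

lemma coord_cost_nonneg: "0 \<le> coord_cost p x y"
  unfolding coord_cost_def by (intro sum_nonneg) simp

lemma vec_nth_measurable [measurable]: "(\<lambda>x :: real ^ 'n. x $ k) \<in> borel_measurable borel"
  by (intro borel_measurable_continuous_onI continuous_intros)

lemma coord_cost_measurable [measurable]:
  "(\<lambda>z. coord_cost p (fst z) (snd z)) \<in> borel_measurable (borel \<Otimes>\<^sub>M borel)"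
  unfolding coord_cost_def by measurable

lemma dist_powr_le_coord_cost:
  assumes "0 < p"
  shows "dist x y powr p \<le> real CARD('n) powr p * coord_cost p x (y :: real ^ 'n)"
proof -
  obtain k where k: "\<And>i. \<bar>x $ i - y $ i\<bar> \<le> \<bar>x $ k - y $ k\<bar>"
  proof -
    let ?R = "range (\<lambda>i. \<bar>x $ i - y $ i\<bar>)"
    have "Max ?R \<in> ?R" by (intro Max_in) auto
    then obtain k where "Max ?R = \<bar>x $ k - y $ k\<bar>" by (rule imageE)
    moreover have "\<bar>x $ i - y $ i\<bar> \<le> Max ?R" for i by (intro Max_ge) auto
    ultimately show ?thesis using that by metis
  qed
  have "dist x y \<le> (\<Sum>i\<in>UNIV. \<bar>x $ i - y $ i\<bar>)"
    using norm_le_l1_cart[of "x - y"] by (simp add: dist_norm)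
  also have "\<dots> \<le> real CARD('n) * \<bar>x $ k - y $ k\<bar>"
    using sum_bounded_above[of UNIV "\<lambda>i. \<bar>x $ i - y $ i\<bar>", OF k] by simp
  finally have "dist x y powr p \<le> real CARD('n) powr p * \<bar>x $ k - y $ k\<bar> powr p"
    using assms by (simp add: powr_mono2 flip: powr_mult)
  also have "\<bar>x $ k - y $ k\<bar> powr p \<le> coord_cost p x y"
    unfolding coord_cost_def by (rule member_le_sum) auto
  finally show ?thesis by (simp add: mult_left_mono)
qed

lemma coord_cost_le_dist_powr:
  assumes "0 < p"
  shows "coord_cost p x (y :: real ^ 'n) \<le> real CARD('n) * dist x y powr p"
proof -
  have "\<bar>x $ i - y $ i\<bar> powr p \<le> dist x y powr p" for i
    using assms component_le_norm_cart[of "x - y" i] by (intro powr_mono2) (auto simp: dist_norm)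
  then show ?thesis
    unfolding coord_cost_def using sum_bounded_above[of UNIV "\<lambda>i. \<bar>x $ i - y $ i\<bar> powr p"] by simp
qed

section \<open>Gluing couplings along a countable partition\<close>

text \<open>
  The density, with respect to \<open>\<nu>\<close>, of \<open>\<nu>\<close> conditioned on the cell of the partition \<open>T\<close> that
  contains \<open>y\<close>. On null cells it takes the value \<open>\<infinity>\<close>, which only concerns a null set of \<open>y\<close>.
\<close>

definition cell_kernel :: "'a measure \<Rightarrow> ('a \<Rightarrow> 'c) \<Rightarrow> 'a \<Rightarrow> 'a \<Rightarrow> ennreal"
  where "cell_kernel \<nu> T y z = (if T z = T y then 1 / emeasure \<nu> (T -` {T y} \<inter> space \<nu>) else 0)"

lemma cell_kernel_commute: "cell_kernel \<nu> T y z = cell_kernel \<nu> T z y"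
  by (auto simp: cell_kernel_def)

lemma cell_kernel_measurable:
  fixes T :: "'a \<Rightarrow> 'c::countable"
  assumes [measurable]: "T \<in> measurable N (count_space UNIV)"
    "f \<in> measurable M N" "g \<in> measurable M N"
  shows "(\<lambda>x. cell_kernel \<nu> T (f x) (g x)) \<in> borel_measurable M"
proof -
  \<comment> \<open>The kernel factors through pairs of cells, which form a countable discrete space.\<close>
  define h where "h = (\<lambda>(b, c). if c = b then 1 / emeasure \<nu> (T -` {b} \<inter> space \<nu>) else 0)"
  have "(\<lambda>x. (T (f x), T (g x))) \<in> measurable M (count_space UNIV \<Otimes>\<^sub>M count_space UNIV)"
    by measurable
  then have "(\<lambda>x. (T (f x), T (g x))) \<in> measurable M (count_space UNIV)"
    by (simp add: pair_measure_countable)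
  then have "(\<lambda>x. h (T (f x), T (g x))) \<in> borel_measurable M"
    by (rule measurable_compose) simp
  then show ?thesis by (simp add: h_def cell_kernel_def)
qed

text \<open>
  Since there are only countably many cells, almost every point lies in a cell of positive mass.
\<close>

lemma AE_nn_integral_cell_kernel:
  fixes T :: "'a \<Rightarrow> 'c::countable"
  assumes "prob_space \<nu>" and [measurable]: "T \<in> measurable \<nu> (count_space UNIV)"
  shows "AE y in \<nu>. (\<integral>\<^sup>+z. cell_kernel \<nu> T y z \<partial>\<nu>) = 1"
proof -
  interpret prob_space \<nu> by fact
  let ?cell = "\<lambda>c. T -` {c} \<inter> space \<nu>"
  have cell [measurable]: "?cell c \<in> sets \<nu>" for c by measurable
  have "AE y in \<nu>. \<forall>c. emeasure \<nu> (?cell c) = 0 \<longrightarrow> y \<notin> ?cell c"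
  proof (subst AE_all_countable, intro allI)
    fix c
    show "AE y in \<nu>. emeasure \<nu> (?cell c) = 0 \<longrightarrow> y \<notin> ?cell c"
    proof (cases "emeasure \<nu> (?cell c) = 0")
      case True
      then have "AE y in \<nu>. y \<notin> ?cell c" using cell by (intro AE_not_in null_setsI)
      then show ?thesis by eventually_elim blast
    qed simp
  qed
  then show ?thesis
  proof (rule AE_mp, intro AE_I2 impI)
    fix y assume y: "y \<in> space \<nu>" and "\<forall>c. emeasure \<nu> (?cell c) = 0 \<longrightarrow> y \<notin> ?cell c"
    then have pos: "emeasure \<nu> (?cell (T y)) \<noteq> 0" by auto
    have "(\<integral>\<^sup>+z. cell_kernel \<nu> T y z \<partial>\<nu>)
        = (\<integral>\<^sup>+z. 1 / emeasure \<nu> (?cell (T y)) * indicator (?cell (T y)) z \<partial>\<nu>)"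
      by (intro nn_integral_cong) (auto simp: cell_kernel_def indicator_def)
    also have "\<dots> = 1 / emeasure \<nu> (?cell (T y)) * emeasure \<nu> (?cell (T y))"
      by (rule nn_integral_cmult_indicator) (rule cell)
    also have "\<dots> = 1"
      unfolding ennreal_divide_times mult_1
      by (rule ennreal_divide_self[OF pos]) (simp add: less_top[symmetric])
    finally show "(\<integral>\<^sup>+z. cell_kernel \<nu> T y z \<partial>\<nu>) = 1" .
  qed
qed

lemma couplings_nn_integral_fst:
  assumes "\<pi> \<in> couplings \<mu> \<nu>" and "h \<in> borel_measurable borel"
  shows "(\<integral>\<^sup>+z. h (fst z) \<partial>\<pi>) = (\<integral>\<^sup>+x. h x \<partial>\<mu>)"
proof -
  have m: "distr \<pi> borel fst = \<mu>" and sets: "sets \<pi> = sets borel"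
    using assms(1) by (simp_all add: couplings_def)
  note [measurable_cong] = sets[folded borel_prod]
  have "fst \<in> measurable \<pi> borel" by measurable
  then show ?thesis unfolding m[symmetric] using assms(2) by (subst nn_integral_distr) simp_all
qed

lemma couplings_nn_integral_snd:
  assumes "\<pi> \<in> couplings \<mu> \<nu>" and "h \<in> borel_measurable borel"
  shows "(\<integral>\<^sup>+z. h (snd z) \<partial>\<pi>) = (\<integral>\<^sup>+y. h y \<partial>\<nu>)"
proof -
  have m: "distr \<pi> borel snd = \<nu>" and sets: "sets \<pi> = sets borel"
    using assms(1) by (simp_all add: couplings_def)
  note [measurable_cong] = sets[folded borel_prod]
  have "snd \<in> measurable \<pi> borel" by measurable
  then show ?thesis unfolding m[symmetric] using assms(2) by (subst nn_integral_distr) simp_all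
qed

lemma AE_nn_integral_cell_kernel_coupling:
  fixes T :: "'a::polish_space \<Rightarrow> 'c::countable"
  assumes \<pi>: "\<pi> \<in> couplings \<mu> \<nu>" and \<nu>: "prob_space \<nu>" "sets \<nu> = sets borel"
    and T [measurable]: "T \<in> measurable borel (count_space UNIV)"
  shows "AE y in \<nu>. (\<integral>\<^sup>+z. cell_kernel \<nu> T y (snd z) \<partial>\<pi>) = 1"
proof -
  note [measurable] = cell_kernel_measurable[OF T, of _ _ _ \<nu>]
  have "(\<integral>\<^sup>+z. cell_kernel \<nu> T y (snd z) \<partial>\<pi>) = (\<integral>\<^sup>+z. cell_kernel \<nu> T y z \<partial>\<nu>)" for y
    by (intro couplings_nn_integral_snd[OF \<pi>]) measurable
  then show ?thesis
    using AE_nn_integral_cell_kernel[OF \<nu>(1), of T] T by (simp add: measurable_cong_sets[OF \<nu>(2) refl])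
qed

text \<open>
  Conditioning \<open>\<pi>\<close> on the cell of its second coordinate and then averaging over that cell gives
  back \<open>\<pi>\<close>, because the kernel is symmetric and integrates to one in either variable.
\<close>

lemma nn_integral_cell_kernel_disintegrate:
  fixes T :: "'a::polish_space \<Rightarrow> 'c::countable"
  assumes \<pi>: "\<pi> \<in> couplings \<mu> \<nu>" and \<nu>: "prob_space \<nu>" "sets \<nu> = sets borel"
    and T [measurable]: "T \<in> measurable borel (count_space UNIV)"
    and h: "h \<in> borel_measurable borel"
  shows "(\<integral>\<^sup>+y. \<integral>\<^sup>+z. cell_kernel \<nu> T y (snd z) * h z \<partial>\<pi> \<partial>\<nu>) = (\<integral>\<^sup>+z. h z \<partial>\<pi>)"
proof -
  note [measurable] = cell_kernel_measurable[OF T, of _ _ _ \<nu>]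
  have [measurable_cong]: "sets \<pi> = sets (borel \<Otimes>\<^sub>M borel)" "sets \<nu> = sets borel"
    using \<pi> \<nu> unfolding couplings_def borel_prod by simp_all
  have [measurable]: "h \<in> borel_measurable (borel \<Otimes>\<^sub>M borel)"
    using h by (simp add: borel_prod)
  interpret \<nu>: prob_space \<nu> by fact
  interpret \<pi>: prob_space \<pi> using \<pi> by (simp add: couplings_def)
  interpret pair_sigma_finite \<nu> \<pi> ..
  have d: "distr \<pi> borel snd = \<nu>" using \<pi> by (simp add: couplings_def)
  have "AE y in distr \<pi> borel snd. (\<integral>\<^sup>+z. cell_kernel \<nu> T y z \<partial>\<nu>) = 1"
    using AE_nn_integral_cell_kernel[OF \<nu>(1), of T] T unfolding d by (simp add: measurable_cong_sets[OF \<nu>(2) refl])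
  then have one: "AE z in \<pi>. (\<integral>\<^sup>+y. cell_kernel \<nu> T y (snd z) \<partial>\<nu>) = 1"
    unfolding cell_kernel_commute[of \<nu> T _ "snd _"] by (subst (asm) AE_distr_iff) simp_all
  have "(\<integral>\<^sup>+y. \<integral>\<^sup>+z. cell_kernel \<nu> T y (snd z) * h z \<partial>\<pi> \<partial>\<nu>)
      = (\<integral>\<^sup>+z. \<integral>\<^sup>+y. cell_kernel \<nu> T y (snd z) * h z \<partial>\<nu> \<partial>\<pi>)"
    by (intro Fubini'[symmetric]) measurable
  also have "\<dots> = (\<integral>\<^sup>+z. (\<integral>\<^sup>+y. cell_kernel \<nu> T y (snd z) \<partial>\<nu>) * h z \<partial>\<pi>)"
    by (intro nn_integral_cong nn_integral_multc) measurable
  also have "\<dots> = (\<integral>\<^sup>+z. h z \<partial>\<pi>)"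
    by (intro nn_integral_cong_AE) (use one in auto)
  finally show ?thesis .
qed

text \<open>
  Choose \<open>y\<close> from \<open>\<nu>\<close>, then \<open>z\<close> from \<open>\<pi>\<close> and \<open>z'\<close> from \<open>\<pi>'\<close> independently, both conditioned on
  their second coordinate lying in the cell of \<open>y\<close>. The marginals of the pair of first coordinates
  are exactly \<open>\<mu>\<close> and \<open>\<mu>'\<close>, although \<open>z\<close> and \<open>z'\<close> are joined only up to the diameter of a cell.
  A countable partition thus replaces disintegration of measures; the price is an error that is
  removed later by refining the partition.
\<close>

lemma exists_glued_coupling:
  fixes T :: "'a::polish_space \<Rightarrow> 'c::countable"
  assumes \<pi>: "\<pi> \<in> couplings \<mu> \<nu>" and \<pi>': "\<pi>' \<in> couplings \<mu>' \<nu>"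
    and \<nu>: "prob_space \<nu>" "sets \<nu> = sets borel"
    and T [measurable]: "T \<in> measurable borel (count_space UNIV)"
  shows "\<exists>\<gamma>\<in>couplings \<mu> \<mu>'. \<forall>c\<in>borel_measurable borel. (\<integral>\<^sup>+w. c w \<partial>\<gamma>)
    = (\<integral>\<^sup>+y. \<integral>\<^sup>+z. \<integral>\<^sup>+z'. cell_kernel \<nu> T y (snd z) * (cell_kernel \<nu> T y (snd z') * c (fst z, fst z')) \<partial>\<pi>' \<partial>\<pi> \<partial>\<nu>)"
proof -
  note [measurable] = cell_kernel_measurable[OF T, of _ _ _ \<nu>]
  have [measurable_cong]: "sets \<pi> = sets (borel \<Otimes>\<^sub>M borel)" "sets \<pi>' = sets (borel \<Otimes>\<^sub>M borel)" "sets \<nu> = sets borel"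
    using \<pi> \<pi>' \<nu> unfolding couplings_def borel_prod by simp_all
  interpret \<nu>: prob_space \<nu> by fact
  interpret \<pi>: prob_space \<pi> using \<pi> by (simp add: couplings_def)
  interpret \<pi>': prob_space \<pi>' using \<pi>' by (simp add: couplings_def)
  interpret P: pair_prob_space \<pi> \<pi>' ..
  define W where "W u = cell_kernel \<nu> T (fst u) (snd (fst (snd u))) * cell_kernel \<nu> T (fst u) (snd (snd (snd u)))"
    for u :: "'a \<times> ('a \<times> 'a) \<times> ('a \<times> 'a)"
  define \<Gamma> where "\<Gamma> = density (\<nu> \<Otimes>\<^sub>M (\<pi> \<Otimes>\<^sub>M \<pi>')) W"
  define \<gamma> where "\<gamma> = distr \<Gamma> borel (\<lambda>u. (fst (fst (snd u)), fst (snd (snd u))))"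
  have [measurable]: "W \<in> borel_measurable (borel \<Otimes>\<^sub>M ((borel \<Otimes>\<^sub>M borel) \<Otimes>\<^sub>M (borel \<Otimes>\<^sub>M borel)))"
    unfolding W_def by measurable
  have proj [measurable]: "(\<lambda>u. (fst (fst (snd u)), fst (snd (snd u)))) \<in> measurable \<Gamma> borel"
    unfolding \<Gamma>_def borel_prod[symmetric] by measurable
  have integral: "(\<integral>\<^sup>+w. c w \<partial>\<gamma>)
    = (\<integral>\<^sup>+y. \<integral>\<^sup>+z. \<integral>\<^sup>+z'. cell_kernel \<nu> T y (snd z) * (cell_kernel \<nu> T y (snd z') * c (fst z, fst z')) \<partial>\<pi>' \<partial>\<pi> \<partial>\<nu>)"
    if c: "c \<in> borel_measurable borel" for c
  proof -
    have [measurable]: "c \<in> borel_measurable (borel \<Otimes>\<^sub>M borel)" using c by (simp add: borel_prod)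
    have "(\<integral>\<^sup>+w. c w \<partial>\<gamma>) = (\<integral>\<^sup>+u. c (fst (fst (snd u)), fst (snd (snd u))) \<partial>\<Gamma>)"
      unfolding \<gamma>_def using c by (intro nn_integral_distr[OF proj]) simp
    also have "\<dots> = (\<integral>\<^sup>+u. W u * c (fst (fst (snd u)), fst (snd (snd u))) \<partial>(\<nu> \<Otimes>\<^sub>M (\<pi> \<Otimes>\<^sub>M \<pi>')))"
      unfolding \<Gamma>_def by (rule nn_integral_density) measurable
    also have "\<dots> = (\<integral>\<^sup>+y. \<integral>\<^sup>+v. W (y, v) * c (fst (fst v), fst (snd v)) \<partial>(\<pi> \<Otimes>\<^sub>M \<pi>') \<partial>\<nu>)"
      by (subst P.nn_integral_fst[symmetric]) (auto simp: comp_def)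
    also have "\<dots> = (\<integral>\<^sup>+y. \<integral>\<^sup>+z. \<integral>\<^sup>+z'. W (y, z, z') * c (fst z, fst z') \<partial>\<pi>' \<partial>\<pi> \<partial>\<nu>)"
      by (intro nn_integral_cong, subst \<pi>'.nn_integral_fst[symmetric]) auto
    finally show ?thesis by (simp add: W_def mult.assoc)
  qed
  note ae = AE_nn_integral_cell_kernel_coupling[OF \<pi> \<nu> T]
  note ae' = AE_nn_integral_cell_kernel_coupling[OF \<pi>' \<nu> T]
  have sets_\<gamma>: "sets \<gamma> = sets borel" by (simp add: \<gamma>_def)
  have left: "(\<integral>\<^sup>+w. h (fst w) \<partial>\<gamma>) = (\<integral>\<^sup>+x. h x \<partial>\<mu>)" if [measurable]: "h \<in> borel_measurable borel" for h
  proof -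
    have "(\<lambda>w. h (fst w)) \<in> borel_measurable (borel :: ('a \<times> 'a) measure)"
      unfolding borel_prod[symmetric] by measurable
    then have "(\<integral>\<^sup>+w. h (fst w) \<partial>\<gamma>) = (\<integral>\<^sup>+y. \<integral>\<^sup>+z. \<integral>\<^sup>+z'. cell_kernel \<nu> T y (snd z) * (cell_kernel \<nu> T y (snd z') * h (fst z)) \<partial>\<pi>' \<partial>\<pi> \<partial>\<nu>)"
      by (subst integral) auto
    also have "\<dots> = (\<integral>\<^sup>+y. \<integral>\<^sup>+z. cell_kernel \<nu> T y (snd z) * ((\<integral>\<^sup>+z'. cell_kernel \<nu> T y (snd z') \<partial>\<pi>') * h (fst z)) \<partial>\<pi> \<partial>\<nu>)"
      by (simp add: nn_integral_cmult nn_integral_multc)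
    also have "\<dots> = (\<integral>\<^sup>+y. \<integral>\<^sup>+z. cell_kernel \<nu> T y (snd z) * h (fst z) \<partial>\<pi> \<partial>\<nu>)"
      by (intro nn_integral_cong_AE) (use ae' in auto)
    also have "\<dots> = (\<integral>\<^sup>+z. h (fst z) \<partial>\<pi>)"
      by (intro nn_integral_cell_kernel_disintegrate[OF \<pi> \<nu> T]) (simp add: borel_prod[symmetric])
    also have "\<dots> = (\<integral>\<^sup>+x. h x \<partial>\<mu>)" by (intro couplings_nn_integral_fst[OF \<pi>]) measurable
    finally show ?thesis .
  qed
  have right: "(\<integral>\<^sup>+w. h (snd w) \<partial>\<gamma>) = (\<integral>\<^sup>+x. h x \<partial>\<mu>')" if [measurable]: "h \<in> borel_measurable borel" for h
  proof -
    have "(\<lambda>w. h (snd w)) \<in> borel_measurable (borel :: ('a \<times> 'a) measure)"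
      unfolding borel_prod[symmetric] by measurable
    then have "(\<integral>\<^sup>+w. h (snd w) \<partial>\<gamma>) = (\<integral>\<^sup>+y. \<integral>\<^sup>+z. \<integral>\<^sup>+z'. cell_kernel \<nu> T y (snd z) * (cell_kernel \<nu> T y (snd z') * h (fst z')) \<partial>\<pi>' \<partial>\<pi> \<partial>\<nu>)"
      by (subst integral) auto
    also have "\<dots> = (\<integral>\<^sup>+y. (\<integral>\<^sup>+z. cell_kernel \<nu> T y (snd z) \<partial>\<pi>) * (\<integral>\<^sup>+z'. cell_kernel \<nu> T y (snd z') * h (fst z') \<partial>\<pi>') \<partial>\<nu>)"
      by (simp add: nn_integral_cmult nn_integral_multc)
    also have "\<dots> = (\<integral>\<^sup>+y. \<integral>\<^sup>+z'. cell_kernel \<nu> T y (snd z') * h (fst z') \<partial>\<pi>' \<partial>\<nu>)"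
      by (intro nn_integral_cong_AE) (use ae in auto)
    also have "\<dots> = (\<integral>\<^sup>+z. h (fst z) \<partial>\<pi>')"
      by (intro nn_integral_cell_kernel_disintegrate[OF \<pi>' \<nu> T]) (simp add: borel_prod[symmetric])
    also have "\<dots> = (\<integral>\<^sup>+x. h x \<partial>\<mu>')" by (intro couplings_nn_integral_fst[OF \<pi>']) measurable
    finally show ?thesis .
  qed
  have \<mu>: "sets \<mu> = sets borel" "prob_space \<mu>" and \<mu>': "sets \<mu>' = sets borel"
    using \<pi> \<pi>' \<pi>.prob_space_distr[of fst borel] by (auto simp: couplings_def)
  have "distr \<gamma> borel fst = \<mu>"
  proof (rule measure_eqI)
    fix A assume "A \<in> sets (distr \<gamma> borel fst)"
    then have [measurable]: "A \<in> sets borel" by simp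
    have "emeasure (distr \<gamma> borel fst) A = (\<integral>\<^sup>+x. indicator A x \<partial>distr \<gamma> borel fst)" by simp
    also have "\<dots> = (\<integral>\<^sup>+w. indicator A (fst w) \<partial>\<gamma>)"
      by (intro nn_integral_distr) (simp_all add: measurable_cong_sets[OF sets_\<gamma> refl] flip: borel_prod)
    also have "\<dots> = emeasure \<mu> A" using \<mu> by (subst left) auto
    finally show "emeasure (distr \<gamma> borel fst) A = emeasure \<mu> A" .
  qed (simp add: \<mu>)
  moreover have "distr \<gamma> borel snd = \<mu>'"
  proof (rule measure_eqI)
    fix A assume "A \<in> sets (distr \<gamma> borel snd)"
    then have [measurable]: "A \<in> sets borel" by simp
    have "emeasure (distr \<gamma> borel snd) A = (\<integral>\<^sup>+x. indicator A x \<partial>distr \<gamma> borel snd)" by simp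
    also have "\<dots> = (\<integral>\<^sup>+w. indicator A (snd w) \<partial>\<gamma>)"
      by (intro nn_integral_distr) (simp_all add: measurable_cong_sets[OF sets_\<gamma> refl] flip: borel_prod)
    also have "\<dots> = emeasure \<mu>' A" using \<mu>' by (subst right) auto
    finally show "emeasure (distr \<gamma> borel snd) A = emeasure \<mu>' A" .
  qed (simp add: \<mu>')
  moreover have "prob_space \<gamma>"
  proof
    have "emeasure \<gamma> (space \<gamma>) = (\<integral>\<^sup>+w. 1 \<partial>\<gamma>)" by simp
    also have "\<dots> = (\<integral>\<^sup>+x. 1 \<partial>\<mu>)" using left[of "\<lambda>_. 1"] by simp
    also have "\<dots> = 1" using prob_space.emeasure_space_1[OF \<mu>(2)] by simp
    finally show "emeasure \<gamma> (space \<gamma>) = 1" .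
  qed
  ultimately show ?thesis
    using sets_\<gamma> integral by (intro bexI[of _ \<gamma>]) (auto simp: couplings_def)
qed

section \<open>A star inequality for optimal transport\<close>

lemma sum_coord_cost_differences_le:
  fixes X :: "'i \<Rightarrow> 'a \<Rightarrow> real ^ 'n"
  assumes I: "finite I" and M: "\<And>i. i \<in> I \<Longrightarrow> prob_space (M i)"
    and X: "\<And>i. i \<in> I \<Longrightarrow> X i \<in> borel_measurable (M i)" and p: "1 < p"
  shows "(\<Sum>i\<in>I. \<Sum>j\<in>I. \<integral>\<^sup>+x. \<integral>\<^sup>+y. ennreal (coord_cost p (X i x) (X j y)) \<partial>M j \<partial>M i)
    \<le> ennreal (star_const p) * of_nat (card I) * (\<Sum>i\<in>I. \<integral>\<^sup>+x. ennreal (coord_cost p (X i x) c) \<partial>M i)"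
proof -
  have Xk: "(\<lambda>x. X i x $ k) \<in> borel_measurable (M i)" if "i \<in> I" for i k
    using X[OF that] by (rule measurable_compose) measurable
  have split: "ennreal (coord_cost p v w) = (\<Sum>k\<in>UNIV. ennreal (\<bar>v $ k - w $ k\<bar> powr p))" for v w :: "real ^ 'n"
    unfolding coord_cost_def by (simp add: sum_ennreal)
  have double: "(\<integral>\<^sup>+x. \<integral>\<^sup>+y. ennreal (coord_cost p (X i x) (X j y)) \<partial>M j \<partial>M i)
      = (\<Sum>k\<in>UNIV. \<integral>\<^sup>+x. \<integral>\<^sup>+y. ennreal (\<bar>X i x $ k - X j y $ k\<bar> powr p) \<partial>M j \<partial>M i)"
    if "i \<in> I" "j \<in> I" for i j
  proof -
    interpret j: prob_space "M j" by (rule M[OF that(2)])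
    note [measurable] = Xk[OF that(1)] Xk[OF that(2)]
    show ?thesis unfolding split by (simp add: nn_integral_sum del: sum_ennreal)
  qed
  have single: "(\<integral>\<^sup>+x. ennreal (coord_cost p (X i x) c) \<partial>M i)
      = (\<Sum>k\<in>UNIV. \<integral>\<^sup>+x. ennreal (\<bar>X i x $ k - c $ k\<bar> powr p) \<partial>M i)" if "i \<in> I" for i
  proof -
    note [measurable] = Xk[OF that]
    show ?thesis unfolding split by (simp add: nn_integral_sum del: sum_ennreal)
  qed
  have "(\<Sum>i\<in>I. \<Sum>j\<in>I. \<integral>\<^sup>+x. \<integral>\<^sup>+y. ennreal (coord_cost p (X i x) (X j y)) \<partial>M j \<partial>M i)
     = (\<Sum>i\<in>I. \<Sum>j\<in>I. \<Sum>k\<in>UNIV. \<integral>\<^sup>+x. \<integral>\<^sup>+y. ennreal (\<bar>X i x $ k - X j y $ k\<bar> powr p) \<partial>M j \<partial>M i)"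
    by (intro sum.cong refl double)
  also have "\<dots> = (\<Sum>k\<in>UNIV. \<Sum>i\<in>I. \<Sum>j\<in>I. \<integral>\<^sup>+x. \<integral>\<^sup>+y. ennreal (\<bar>X i x $ k - X j y $ k\<bar> powr p) \<partial>M j \<partial>M i)"
    by (simp only: sum.swap[of _ UNIV I])
  also have "\<dots> \<le> (\<Sum>k\<in>UNIV. ennreal (star_const p) * of_nat (card I) * (\<Sum>i\<in>I. \<integral>\<^sup>+x. ennreal (\<bar>X i x $ k - c $ k\<bar> powr p) \<partial>M i))"
    by (intro sum_mono sum_powr_differences_le I M Xk p)
  also have "\<dots> = ennreal (star_const p) * of_nat (card I) * (\<Sum>i\<in>I. \<Sum>k\<in>UNIV. \<integral>\<^sup>+x. ennreal (\<bar>X i x $ k - c $ k\<bar> powr p) \<partial>M i)"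
    by (simp only: sum_distrib_left[symmetric] sum.swap[of _ UNIV I])
  also have "(\<Sum>i\<in>I. \<Sum>k\<in>UNIV. \<integral>\<^sup>+x. ennreal (\<bar>X i x $ k - c $ k\<bar> powr p) \<partial>M i)
     = (\<Sum>i\<in>I. \<integral>\<^sup>+x. ennreal (coord_cost p (X i x) c) \<partial>M i)"
    by (intro sum.cong refl single[symmetric])
  finally show ?thesis .
qed

text \<open>
  An extended nonnegative integral is used so that infima and Fubini arguments need no
  integrability; for measures with finite moments it is comparable to the \<open>p\<close>-th power of the
  Wasserstein distance.
\<close>

definition transport_cost :: "real \<Rightarrow> (real ^ 'n) measure \<Rightarrow> (real ^ 'n) measure \<Rightarrow> ennreal"
  where "transport_cost p \<mu> \<nu> =
    (INF \<pi>\<in>couplings \<mu> \<nu>. \<integral>\<^sup>+z. ennreal (coord_cost p (fst z) (snd z)) \<partial>\<pi>)"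

definition grid :: "real \<Rightarrow> real ^ 'n \<Rightarrow> int ^ 'n"
  where "grid \<delta> y = (\<chi> k. \<lfloor>y $ k / \<delta>\<rfloor>)"

lemma grid_measurable: "grid \<delta> \<in> measurable borel (count_space UNIV)"
  unfolding measurable_count_space_eq2_countable
proof (intro conjI ballI)
  fix a :: "int ^ 'n"
  have "grid \<delta> -` {a} \<inter> space borel = {y. \<forall>k. \<lfloor>y $ k / \<delta>\<rfloor> = a $ k}"
    by (auto simp: grid_def vec_eq_iff)
  also have "\<dots> \<in> sets borel" by measurable
  finally show "grid \<delta> -` {a} \<inter> space borel \<in> sets borel" .
qed simp

lemma grid_eq_imp_close:
  assumes "grid \<delta> y = grid \<delta> z" "0 < \<delta>"
  shows "\<bar>y $ k - z $ k\<bar> \<le> \<delta>"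
proof -
  have "\<lfloor>y $ k / \<delta>\<rfloor> = \<lfloor>z $ k / \<delta>\<rfloor>" using assms(1) by (simp add: grid_def vec_eq_iff)
  then have "\<bar>y $ k / \<delta> - z $ k / \<delta>\<bar> < 1" by linarith
  then show ?thesis using assms(2) by (simp add: field_simps flip: diff_divide_distrib)
qed

text \<open>
  An upper bound for the cost of moving to an arbitrary point of the cell of \<open>y\<close>.
\<close>

definition fuzzy_cost :: "real \<Rightarrow> real \<Rightarrow> real ^ 'n \<Rightarrow> real ^ 'n \<Rightarrow> real"
  where "fuzzy_cost p \<delta> x y = (\<Sum>k\<in>UNIV. (\<bar>x $ k - y $ k\<bar> + \<delta>) powr p)"

lemma fuzzy_cost_measurable [measurable]:
  "(\<lambda>z. fuzzy_cost p \<delta> (fst z) (snd z)) \<in> borel_measurable (borel \<Otimes>\<^sub>M borel)"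
  unfolding fuzzy_cost_def by measurable

text \<open>
  All pairs of leaves are glued through the centre \<open>\<nu>\<close> of the star. Conditionally on the cell of
  the centre point \<open>y\<close> the leaves are independent, so the inequality for independent random vectors
  applies with \<open>c = y\<close>. Integration over \<open>y\<close> then restores the couplings \<open>\<pi> i\<close> themselves.
\<close>

lemma sum_transport_cost_le_fuzzy:
  fixes \<mu> :: "'i \<Rightarrow> (real ^ 'n) measure"
  assumes I: "finite I" and \<pi>: "\<And>i. i \<in> I \<Longrightarrow> \<pi> i \<in> couplings (\<mu> i) \<nu>"
    and \<nu>: "prob_space \<nu>" "sets \<nu> = sets borel" and p: "1 < p" and \<delta>: "0 < \<delta>"
  shows "(\<Sum>i\<in>I. \<Sum>j\<in>I. transport_cost p (\<mu> i) (\<mu> j))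
    \<le> ennreal (star_const p) * of_nat (card I) *
        (\<Sum>i\<in>I. \<integral>\<^sup>+z. ennreal (fuzzy_cost p \<delta> (fst z) (snd z)) \<partial>\<pi> i)"
proof -
  let ?T = "grid \<delta> :: real ^ 'n \<Rightarrow> int ^ 'n"
  let ?w = "cell_kernel \<nu> ?T"
  let ?c = "\<lambda>z. ennreal (coord_cost p (fst z) (snd z))"
  let ?h = "\<lambda>z. ennreal (fuzzy_cost p \<delta> (fst z) (snd z))"
  let ?K = "ennreal (star_const p) * of_nat (card I)"
  note [measurable] = cell_kernel_measurable[OF grid_measurable, of _ _ _ \<nu>]
  have sets_\<pi>: "sets (\<pi> i) = sets (borel \<Otimes>\<^sub>M borel)" and prob_\<pi>: "prob_space (\<pi> i)" if "i \<in> I" for i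
    using \<pi>[OF that] unfolding couplings_def borel_prod by simp_all
  have [measurable_cong]: "sets \<nu> = sets borel" by (rule \<nu>)
  define G where "G i j y = (\<integral>\<^sup>+z. \<integral>\<^sup>+z'. ?w y (snd z) * (?w y (snd z') * ennreal (coord_cost p (fst z) (fst z'))) \<partial>\<pi> j \<partial>\<pi> i)" for i j y
  define H where "H i y = (\<integral>\<^sup>+z. ?w y (snd z) * ?h z \<partial>\<pi> i)" for i y
  have G_measurable: "G i j \<in> borel_measurable \<nu>" if "i \<in> I" "j \<in> I" for i j
  proof -
    interpret i: prob_space "\<pi> i" by (rule prob_\<pi>[OF that(1)])
    interpret j: prob_space "\<pi> j" by (rule prob_\<pi>[OF that(2)])
    note [measurable_cong] = sets_\<pi>[OF that(1)] sets_\<pi>[OF that(2)]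
    have [measurable]: "(\<lambda>u. coord_cost p (f u) (g u)) \<in> borel_measurable M"
      if [measurable]: "f \<in> borel_measurable M" "g \<in> borel_measurable M" for f g :: "'z \<Rightarrow> real ^ 'n" and M
      unfolding coord_cost_def by measurable
    show ?thesis unfolding G_def coord_cost_def by measurable
  qed
  have H_measurable: "H i \<in> borel_measurable \<nu>" if "i \<in> I" for i
  proof -
    interpret i: prob_space "\<pi> i" by (rule prob_\<pi>[OF that])
    note [measurable_cong] = sets_\<pi>[OF that]
    show ?thesis unfolding H_def by measurable
  qed
  have glue: "transport_cost p (\<mu> i) (\<mu> j) \<le> (\<integral>\<^sup>+y. G i j y \<partial>\<nu>)" if "i \<in> I" "j \<in> I" for i j
  proof -
    note \<pi>_ij = \<pi>[OF that(1)] \<pi>[OF that(2)]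
    obtain \<gamma> where \<gamma>: "\<gamma> \<in> couplings (\<mu> i) (\<mu> j)"
      and eq: "\<And>c. c \<in> borel_measurable borel \<Longrightarrow> (\<integral>\<^sup>+w. c w \<partial>\<gamma>)
        = (\<integral>\<^sup>+y. \<integral>\<^sup>+z. \<integral>\<^sup>+z'. ?w y (snd z) * (?w y (snd z') * c (fst z, fst z')) \<partial>\<pi> j \<partial>\<pi> i \<partial>\<nu>)"
      using exists_glued_coupling[OF \<pi>_ij \<nu> grid_measurable[of \<delta>]] by blast
    have "?c \<in> borel_measurable borel" unfolding borel_prod[symmetric] by measurable
    from eq[OF this] have "(\<integral>\<^sup>+w. ?c w \<partial>\<gamma>) = (\<integral>\<^sup>+y. G i j y \<partial>\<nu>)"
      by (simp only: G_def fst_conv snd_conv)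
    then show ?thesis unfolding transport_cost_def
      by (metis (no_types, lifting) INF_lower \<gamma>)
  qed
  have "AE y in \<nu>. \<forall>i\<in>I. (\<integral>\<^sup>+z. ?w y (snd z) \<partial>\<pi> i) = 1"
    using I \<pi> by (intro AE_finite_allI AE_nn_integral_cell_kernel_coupling[OF _ \<nu> grid_measurable])
  then have pointwise: "AE y in \<nu>. (\<Sum>i\<in>I. \<Sum>j\<in>I. G i j y) \<le> ?K * (\<Sum>i\<in>I. H i y)"
  proof eventually_elim
    fix y assume one: "\<forall>i\<in>I. (\<integral>\<^sup>+z. ?w y (snd z) \<partial>\<pi> i) = 1"
    define M where "M i = density (\<pi> i) (\<lambda>z. ?w y (snd z))" for i
    have w_measurable: "(\<lambda>z. ?w y (snd z)) \<in> borel_measurable (\<pi> i)" if "i \<in> I" for i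
    proof -
      note [measurable_cong] = sets_\<pi>[OF that]
      show ?thesis by measurable
    qed
    have M: "prob_space (M i)" if "i \<in> I" for i
    proof
      show "emeasure (M i) (space (M i)) = 1"
        using one that w_measurable[OF that] by (simp add: M_def emeasure_density)
    qed
    have fst_measurable: "fst \<in> borel_measurable (M i)" if "i \<in> I" for i
    proof -
      note [measurable_cong] = sets_\<pi>[OF that]
      show ?thesis unfolding M_def by measurable
    qed
    have cost_measurable: "(\<lambda>z'. ennreal (coord_cost p v (fst z'))) \<in> borel_measurable (\<pi> i)"
      "(\<lambda>z'. ennreal (coord_cost p (fst z') v)) \<in> borel_measurable (\<pi> i)" if "i \<in> I" for i v
    proof -
      note [measurable_cong] = sets_\<pi>[OF that]
      show "(\<lambda>z'. ennreal (coord_cost p v (fst z'))) \<in> borel_measurable (\<pi> i)"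
        "(\<lambda>z'. ennreal (coord_cost p (fst z') v)) \<in> borel_measurable (\<pi> i)"
        unfolding coord_cost_def by measurable
    qed
    have G: "G i j y = (\<integral>\<^sup>+z. \<integral>\<^sup>+z'. ennreal (coord_cost p (fst z) (fst z')) \<partial>M j \<partial>M i)"
      if "i \<in> I" "j \<in> I" for i j
    proof -
      interpret j: prob_space "\<pi> j" by (rule prob_\<pi>[OF that(2)])
      note [measurable_cong] = sets_\<pi>[OF that(1)] sets_\<pi>[OF that(2)]
      have "(\<integral>\<^sup>+z'. ennreal (coord_cost p (fst z) (fst z')) \<partial>M j)
          = (\<integral>\<^sup>+z'. ?w y (snd z') * ennreal (coord_cost p (fst z) (fst z')) \<partial>\<pi> j)" for z :: "(real ^ 'n) \<times> (real ^ 'n)"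
        unfolding M_def by (intro nn_integral_density w_measurable cost_measurable that)
      moreover have "(\<lambda>z. \<integral>\<^sup>+z'. ?w y (snd z') * ennreal (coord_cost p (fst z) (fst z')) \<partial>\<pi> j) \<in> borel_measurable (\<pi> i)"
        unfolding coord_cost_def by measurable
      ultimately have "(\<integral>\<^sup>+z. \<integral>\<^sup>+z'. ennreal (coord_cost p (fst z) (fst z')) \<partial>M j \<partial>M i)
          = (\<integral>\<^sup>+z. ?w y (snd z) * (\<integral>\<^sup>+z'. ?w y (snd z') * ennreal (coord_cost p (fst z) (fst z')) \<partial>\<pi> j) \<partial>\<pi> i)"
        unfolding M_def[of i] using w_measurable[OF that(1)] by (simp add: nn_integral_density)
      also have "\<dots> = G i j y"
        unfolding G_def
        by (intro nn_integral_cong nn_integral_cmult[symmetric] borel_measurable_times_ennreal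
            w_measurable cost_measurable that)
      finally show ?thesis by simp
    qed
    have H: "(\<integral>\<^sup>+z. ennreal (coord_cost p (fst z) y) \<partial>M i) \<le> H i y" if "i \<in> I" for i
    proof -
      have close: "coord_cost p x y \<le> fuzzy_cost p \<delta> x y'" if "?T y' = ?T y" for x y'
        unfolding coord_cost_def fuzzy_cost_def
      proof (intro sum_mono powr_mono2)
        fix k
        show "\<bar>x $ k - y $ k\<bar> \<le> \<bar>x $ k - y' $ k\<bar> + \<delta>"
          using grid_eq_imp_close[OF that \<delta>, of k] by linarith
      qed (use p in auto)
      have "(\<integral>\<^sup>+z. ennreal (coord_cost p (fst z) y) \<partial>M i)
          = (\<integral>\<^sup>+z. ?w y (snd z) * ennreal (coord_cost p (fst z) y) \<partial>\<pi> i)"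
        unfolding M_def by (intro nn_integral_density w_measurable cost_measurable that)
      also have "\<dots> \<le> H i y"
        unfolding H_def cell_kernel_def
        by (intro nn_integral_mono) (auto intro!: mult_left_mono ennreal_leI close)
      finally show ?thesis .
    qed
    have "(\<Sum>i\<in>I. \<Sum>j\<in>I. G i j y)
        = (\<Sum>i\<in>I. \<Sum>j\<in>I. \<integral>\<^sup>+z. \<integral>\<^sup>+z'. ennreal (coord_cost p (fst z) (fst z')) \<partial>M j \<partial>M i)"
      by (intro sum.cong refl G)
    also have "\<dots> \<le> ?K * (\<Sum>i\<in>I. \<integral>\<^sup>+z. ennreal (coord_cost p (fst z) y) \<partial>M i)"
      by (intro sum_coord_cost_differences_le I M fst_measurable p)
    also have "\<dots> \<le> ?K * (\<Sum>i\<in>I. H i y)"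
      by (intro mult_left_mono sum_mono H) auto
    finally show "(\<Sum>i\<in>I. \<Sum>j\<in>I. G i j y) \<le> ?K * (\<Sum>i\<in>I. H i y)" .
  qed
  have "(\<Sum>i\<in>I. \<Sum>j\<in>I. transport_cost p (\<mu> i) (\<mu> j)) \<le> (\<Sum>i\<in>I. \<Sum>j\<in>I. \<integral>\<^sup>+y. G i j y \<partial>\<nu>)"
    by (intro sum_mono glue)
  also have "\<dots> = (\<integral>\<^sup>+y. (\<Sum>i\<in>I. \<Sum>j\<in>I. G i j y) \<partial>\<nu>)"
    by (simp add: nn_integral_sum G_measurable borel_measurable_sum)
  also have "\<dots> \<le> (\<integral>\<^sup>+y. ?K * (\<Sum>i\<in>I. H i y) \<partial>\<nu>)"
    by (rule nn_integral_mono_AE) (rule pointwise)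
  also have "\<dots> = ?K * (\<Sum>i\<in>I. \<integral>\<^sup>+y. H i y \<partial>\<nu>)"
    by (simp add: nn_integral_cmult nn_integral_sum H_measurable borel_measurable_sum)
  also have "(\<Sum>i\<in>I. \<integral>\<^sup>+y. H i y \<partial>\<nu>) = (\<Sum>i\<in>I. \<integral>\<^sup>+z. ?h z \<partial>\<pi> i)"
    unfolding H_def
    by (intro sum.cong refl nn_integral_cell_kernel_disintegrate[OF \<pi> \<nu> grid_measurable])
       (simp_all flip: borel_prod)
  finally show ?thesis .
qed

lemma nn_integral_fuzzy_cost_tendsto:
  assumes sets: "sets \<pi> = sets borel" and \<pi>: "finite_measure \<pi>"
    and fin: "(\<integral>\<^sup>+z. ennreal (coord_cost p (fst z) (snd z)) \<partial>\<pi>) < \<infinity>" and p: "1 < p"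
  shows "(\<lambda>n. \<integral>\<^sup>+z. ennreal (fuzzy_cost p (inverse (real (Suc n))) (fst z) (snd z)) \<partial>\<pi>)
    \<longlonglongrightarrow> (\<integral>\<^sup>+z. ennreal (coord_cost p (fst z) (snd z :: real ^ 'n)) \<partial>\<pi>)"
proof (rule nn_integral_dominated_convergence)
  note [measurable_cong] = sets[folded borel_prod]
  interpret finite_measure \<pi> by fact
  \<comment> \<open>A dominating function: \<open>a + \<delta> \<le> 2 max a 1\<close> for \<open>\<delta> \<le> 1\<close>.\<close>
  let ?w = "\<lambda>z. ennreal (2 powr p) * (ennreal (coord_cost p (fst z) (snd z)) + of_nat CARD('n))"
  show "(\<lambda>z. ennreal (fuzzy_cost p (inverse (real (Suc n))) (fst z) (snd z))) \<in> borel_measurable \<pi>" for n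
    by measurable
  show [measurable]: "(\<lambda>z. ennreal (coord_cost p (fst z) (snd z))) \<in> borel_measurable \<pi>" "?w \<in> borel_measurable \<pi>"
    by measurable
  have "(\<integral>\<^sup>+z. ?w z \<partial>\<pi>) = ennreal (2 powr p) * ((\<integral>\<^sup>+z. ennreal (coord_cost p (fst z) (snd z)) \<partial>\<pi>) + of_nat CARD('n) * emeasure \<pi> (space \<pi>))"
    by (simp add: nn_integral_cmult nn_integral_add)
  also have "\<dots> < \<infinity>" using fin by (simp add: ennreal_mult_less_top less_top[symmetric] emeasure_finite ennreal_mult_eq_top_iff)
  finally show "(\<integral>\<^sup>+z. ?w z \<partial>\<pi>) < \<infinity>" .
  show "AE z in \<pi>. ennreal (fuzzy_cost p (inverse (real (Suc n))) (fst z) (snd z)) \<le> ?w z" for n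
  proof (rule AE_I2)
    fix z :: "(real ^ 'n) \<times> (real ^ 'n)"
    have "(a + inverse (real (Suc n))) powr p \<le> 2 powr p * (a powr p + 1)" if "0 \<le> a" for a
    proof -
      have "inverse (real (Suc n)) \<le> 1" by (simp add: field_simps)
      then have "(a + inverse (real (Suc n))) powr p \<le> (2 * max a 1) powr p"
        using that p by (intro powr_mono2) auto
      also have "\<dots> = 2 powr p * max a 1 powr p" using that by (simp add: powr_mult)
      also have "max a 1 powr p \<le> a powr p + 1" by (auto simp: max_def)
      finally show ?thesis by simp
    qed
    then have "fuzzy_cost p (inverse (real (Suc n))) (fst z) (snd z) \<le> (\<Sum>k\<in>UNIV. 2 powr p * (\<bar>fst z $ k - snd z $ k\<bar> powr p + 1))"
      unfolding fuzzy_cost_def by (intro sum_mono) auto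
    also have "\<dots> = 2 powr p * (coord_cost p (fst z) (snd z) + CARD('n))"
      by (simp add: coord_cost_def sum.distrib flip: sum_distrib_left)
    finally show "ennreal (fuzzy_cost p (inverse (real (Suc n))) (fst z) (snd z)) \<le> ?w z"
      by (auto dest!: ennreal_leI simp: ennreal_mult coord_cost_nonneg ennreal_of_nat_eq_real_of_nat)
  qed
  show "AE z in \<pi>. (\<lambda>n. ennreal (fuzzy_cost p (inverse (real (Suc n))) (fst z) (snd z)))
      \<longlonglongrightarrow> ennreal (coord_cost p (fst z) (snd z))"
  proof (rule AE_I2, rule tendsto_ennrealI)
    fix z :: "(real ^ 'n) \<times> (real ^ 'n)"
    have "(\<lambda>n. fuzzy_cost p (inverse (real (Suc n))) (fst z) (snd z))
      \<longlonglongrightarrow> (\<Sum>k\<in>UNIV. (\<bar>fst z $ k - snd z $ k\<bar> + 0) powr p)"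
      unfolding fuzzy_cost_def using p
      by (intro tendsto_sum tendsto_powr' tendsto_add tendsto_const LIMSEQ_inverse_real_of_nat) auto
    then show "(\<lambda>n. fuzzy_cost p (inverse (real (Suc n))) (fst z) (snd z)) \<longlonglongrightarrow> coord_cost p (fst z) (snd z)"
      by (simp add: coord_cost_def)
  qed
qed

lemma couplings_nonempty:
  assumes "prob_space \<mu>" "sets \<mu> = sets borel" "prob_space \<nu>" "sets \<nu> = sets borel"
  shows "couplings \<mu> \<nu> \<noteq> {}"
proof -
  interpret \<mu>: prob_space \<mu> by fact
  interpret \<nu>: prob_space \<nu> by fact
  interpret pair_prob_space \<mu> \<nu> ..
  have "sets (\<mu> \<Otimes>\<^sub>M \<nu>) = sets borel"
    unfolding borel_prod[symmetric] using assms by (intro sets_pair_measure_cong)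
  moreover have "distr (\<mu> \<Otimes>\<^sub>M \<nu>) borel fst = \<mu>"
  proof (rule measure_eqI)
    fix A assume "A \<in> sets (distr (\<mu> \<Otimes>\<^sub>M \<nu>) borel fst)"
    then have A: "A \<in> sets \<mu>" using assms by simp
    have "emeasure (distr (\<mu> \<Otimes>\<^sub>M \<nu>) borel fst) A = emeasure (\<mu> \<Otimes>\<^sub>M \<nu>) (A \<times> space \<nu>)"
      using A sets.sets_into_space[OF A] assms
      by (subst emeasure_distr) (auto simp: space_pair_measure measurable_cong_sets[OF refl assms(2)[symmetric]]
            intro!: arg_cong[where f="emeasure _"])
    then show "emeasure (distr (\<mu> \<Otimes>\<^sub>M \<nu>) borel fst) A = emeasure \<mu> A"
      using A by (simp add: \<nu>.emeasure_pair_measure_Times \<nu>.emeasure_space_1)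
  qed (simp add: assms)
  moreover have "distr (\<mu> \<Otimes>\<^sub>M \<nu>) borel snd = \<nu>"
  proof (rule measure_eqI)
    fix A assume "A \<in> sets (distr (\<mu> \<Otimes>\<^sub>M \<nu>) borel snd)"
    then have A: "A \<in> sets \<nu>" using assms by simp
    have "emeasure (distr (\<mu> \<Otimes>\<^sub>M \<nu>) borel snd) A = emeasure (\<mu> \<Otimes>\<^sub>M \<nu>) (space \<mu> \<times> A)"
      using A sets.sets_into_space[OF A] assms
      by (subst emeasure_distr) (auto simp: space_pair_measure measurable_cong_sets[OF refl assms(4)[symmetric]]
            intro!: arg_cong[where f="emeasure _"])
    then show "emeasure (distr (\<mu> \<Otimes>\<^sub>M \<nu>) borel snd) A = emeasure \<nu> A"
      using A by (simp add: \<nu>.emeasure_pair_measure_Times \<mu>.emeasure_space_1)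
  qed (simp add: assms)
  ultimately have "\<mu> \<Otimes>\<^sub>M \<nu> \<in> couplings \<mu> \<nu>"
    using prob_space_axioms by (simp add: couplings_def)
  then show ?thesis by blast
qed

text \<open>
  Every coupling bounds the Wasserstein distance from above, so its cost may be compared
  integrand by integrand.
\<close>

lemma wasserstein_dist_le_transport_cost:
  fixes \<mu> \<nu> :: "(real ^ 'n) measure"
  assumes p: "1 < p" and \<mu>: "\<mu> \<in> wasserstein_space p" and \<nu>: "\<nu> \<in> wasserstein_space p"
  shows "ennreal (wasserstein_dist p \<mu> \<nu> powr p) \<le> ennreal (real CARD('n) powr p) * transport_cost p \<mu> \<nu>"
proof -
  have bound: "ennreal (wasserstein_dist p \<mu> \<nu> powr p / real CARD('n) powr p)
      \<le> (\<integral>\<^sup>+z. ennreal (coord_cost p (fst z) (snd z)) \<partial>\<pi>)" if \<pi>: "\<pi> \<in> couplings \<mu> \<nu>" for \<pi>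
  proof -
    let ?I = "\<integral>z. dist (fst z) (snd z) powr p \<partial>\<pi>"
    have [measurable_cong]: "sets \<pi> = sets (borel \<Otimes>\<^sub>M borel)"
      using \<pi> unfolding couplings_def borel_prod by simp
    have "0 \<le> wasserstein_dist p \<mu> \<nu>"
      unfolding wasserstein_dist_def using \<pi> by (intro cINF_greatest) auto
    moreover have "wasserstein_dist p \<mu> \<nu> \<le> ?I powr (1 / p)"
      unfolding wasserstein_dist_def by (intro cINF_lower \<pi> bdd_belowI[of _ 0]) auto
    ultimately have "wasserstein_dist p \<mu> \<nu> powr p \<le> (?I powr (1 / p)) powr p"
      using p by (intro powr_mono2) auto
    also have "\<dots> = ?I" using p by (simp add: powr_powr)
    finally have "ennreal (wasserstein_dist p \<mu> \<nu> powr p / real CARD('n) powr p) \<le> ennreal (?I / real CARD('n) powr p)"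
      by (intro ennreal_leI divide_right_mono) auto
    also have "\<dots> = ennreal (\<integral>z. dist (fst z) (snd z) powr p / real CARD('n) powr p \<partial>\<pi>)" by simp
    also have "\<dots> = (\<integral>\<^sup>+z. ennreal (dist (fst z) (snd z) powr p / real CARD('n) powr p) \<partial>\<pi>)"
      using integrable_coupling_cost[OF _ \<mu> \<nu> \<pi>] p by (intro nn_integral_eq_integral[symmetric]) auto
    also have "\<dots> \<le> (\<integral>\<^sup>+z. ennreal (coord_cost p (fst z) (snd z)) \<partial>\<pi>)"
    proof (intro nn_integral_mono ennreal_leI)
      fix z :: "(real ^ 'n) \<times> (real ^ 'n)"
      show "dist (fst z) (snd z) powr p / real CARD('n) powr p \<le> coord_cost p (fst z) (snd z)"
        using dist_powr_le_coord_cost[of p "fst z" "snd z"] p by (simp add: field_simps)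
    qed
    finally show ?thesis .
  qed
  then have "ennreal (wasserstein_dist p \<mu> \<nu> powr p / real CARD('n) powr p) \<le> transport_cost p \<mu> \<nu>"
    unfolding transport_cost_def by (rule INF_greatest)
  then have "ennreal (real CARD('n) powr p) * ennreal (wasserstein_dist p \<mu> \<nu> powr p / real CARD('n) powr p)
      \<le> ennreal (real CARD('n) powr p) * transport_cost p \<mu> \<nu>"
    by (intro mult_left_mono) auto
  then show ?thesis by (simp flip: ennreal_mult)
qed

lemma coupling_coord_cost_le:
  fixes \<mu> \<nu> :: "(real ^ 'n) measure"
  assumes p: "1 < p" and \<mu>: "\<mu> \<in> wasserstein_space p" and \<nu>: "\<nu> \<in> wasserstein_space p"
    and \<pi>: "\<pi> \<in> couplings \<mu> \<nu>"
  shows "(\<integral>\<^sup>+z. ennreal (coord_cost p (fst z) (snd z)) \<partial>\<pi>)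
    \<le> ennreal (real CARD('n) * (\<integral>z. dist (fst z) (snd z) powr p \<partial>\<pi>))"
proof -
  have "(\<integral>\<^sup>+z. ennreal (coord_cost p (fst z) (snd z)) \<partial>\<pi>)
      \<le> (\<integral>\<^sup>+z. ennreal (real CARD('n) * dist (fst z) (snd z) powr p) \<partial>\<pi>)"
    using p by (intro nn_integral_mono ennreal_leI coord_cost_le_dist_powr) simp
  also have "\<dots> = ennreal (\<integral>z. real CARD('n) * dist (fst z) (snd z) powr p \<partial>\<pi>)"
    using integrable_coupling_cost[OF _ \<mu> \<nu> \<pi>] p by (intro nn_integral_eq_integral) auto
  finally show ?thesis by simp
qed

lemma wasserstein_spaceD:
  assumes "\<mu> \<in> wasserstein_space p"
  shows "prob_space \<mu>" "sets \<mu> = sets borel"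
  using assms by (auto simp: wasserstein_space_def)

lemma transport_cost_le_wasserstein_dist:
  fixes \<mu> \<nu> :: "(real ^ 'n) measure"
  assumes p: "1 < p" and \<mu>: "\<mu> \<in> wasserstein_space p" and \<nu>: "\<nu> \<in> wasserstein_space p"
  shows "transport_cost p \<mu> \<nu> \<le> ennreal (real CARD('n) * wasserstein_dist p \<mu> \<nu> powr p)"
proof -
  have ne: "couplings \<mu> \<nu> \<noteq> {}"
    by (intro couplings_nonempty wasserstein_spaceD[OF \<mu>] wasserstein_spaceD[OF \<nu>])
  have le: "transport_cost p \<mu> \<nu> \<le> ennreal (real CARD('n) * (\<integral>z. dist (fst z) (snd z) powr p \<partial>\<pi>))"
    if "\<pi> \<in> couplings \<mu> \<nu>" for \<pi>
    unfolding transport_cost_def by (intro INF_lower2[OF that] coupling_coord_cost_le[OF p \<mu> \<nu> that])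
  obtain \<pi>0 where "\<pi>0 \<in> couplings \<mu> \<nu>" using ne by blast
  from le[OF this] have "transport_cost p \<mu> \<nu> < \<top>" by (rule le_less_trans) simp
  then obtain r where r: "transport_cost p \<mu> \<nu> = ennreal r" "0 \<le> r"
    by (cases "transport_cost p \<mu> \<nu>") auto
  have "(r / real CARD('n)) powr (1 / p) \<le> wasserstein_dist p \<mu> \<nu>"
    unfolding wasserstein_dist_def
  proof (rule cINF_greatest[OF ne])
    fix \<pi> assume "\<pi> \<in> couplings \<mu> \<nu>"
    then have "r \<le> real CARD('n) * (\<integral>z. dist (fst z) (snd z) powr p \<partial>\<pi>)"
      using le[of \<pi>] r by (simp add: ennreal_le_iff)
    then show "(r / real CARD('n)) powr (1 / p) \<le> (\<integral>z. dist (fst z) (snd z) powr p \<partial>\<pi>) powr (1 / p)"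
      using p r by (intro powr_mono2) (auto simp: field_simps)
  qed
  then have "((r / real CARD('n)) powr (1 / p)) powr p \<le> wasserstein_dist p \<mu> \<nu> powr p"
    using p by (intro powr_mono2) auto
  then have "r \<le> real CARD('n) * wasserstein_dist p \<mu> \<nu> powr p"
    using p r by (simp add: powr_powr field_simps)
  then show ?thesis using r by (simp add: ennreal_leI)
qed

text \<open>
  The star inequality: the cost between two random leaves is at most \<^term>\<open>star_const p\<close> times
  the mean cost from the leaves to the centre. A star has no cycles, so its edges can be glued
  simultaneously; that is why an inequality for vectors passes to measures with the same constant.
  Near-optimal couplings are glued along grids of mesh tending to zero.
\<close>

lemma sum_transport_cost_le:
  fixes \<mu> :: "'i \<Rightarrow> (real ^ 'n) measure"
  assumes I: "finite I" and p: "1 < p"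
    and \<mu>: "\<And>i. i \<in> I \<Longrightarrow> \<mu> i \<in> wasserstein_space p" and \<nu>: "\<nu> \<in> wasserstein_space p"
  shows "(\<Sum>i\<in>I. \<Sum>j\<in>I. enn2real (transport_cost p (\<mu> i) (\<mu> j)))
    \<le> star_const p * real (card I) * (\<Sum>i\<in>I. enn2real (transport_cost p (\<mu> i) \<nu>))"
proof (rule field_le_epsilon)
  fix e :: real assume "0 < e"
  let ?K = "star_const p * real (card I)"
  have K: "0 \<le> ?K" by (simp add: star_const_def)
  \<comment> \<open>Chosen so that the slack \<open>e'\<close> allowed in each coupling adds up to at most \<open>e\<close>; adding one
    keeps the denominator positive.\<close>
  define e' where "e' = e / (?K * card I + 1)"
  have e': "0 < e'" using \<open>0 < e\<close> K by (simp add: e'_def add_nonneg_pos)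
  have finite_cost: "transport_cost p \<mu> \<nu> < \<top>" if "\<mu> \<in> wasserstein_space p" "\<nu> \<in> wasserstein_space p" for \<mu> \<nu> :: "(real ^ 'n) measure"
    using transport_cost_le_wasserstein_dist[OF p that] by (rule le_less_trans) simp
  have ennreal_cost: "transport_cost p \<mu> \<nu> = ennreal (enn2real (transport_cost p \<mu> \<nu>))"
    if "\<mu> \<in> wasserstein_space p" "\<nu> \<in> wasserstein_space p" for \<mu> \<nu> :: "(real ^ 'n) measure"
    using finite_cost[OF that] by simp
  have "\<exists>\<pi>\<in>couplings (\<mu> i) \<nu>. (\<integral>\<^sup>+z. ennreal (coord_cost p (fst z) (snd z)) \<partial>\<pi>)
      < ennreal (enn2real (transport_cost p (\<mu> i) \<nu>) + e')" if "i \<in> I" for i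
  proof -
    have "transport_cost p (\<mu> i) \<nu> < ennreal (enn2real (transport_cost p (\<mu> i) \<nu>) + e')"
      by (subst ennreal_cost[OF \<mu>[OF that] \<nu>]) (use e' in \<open>auto intro!: ennreal_lessI add_nonneg_pos\<close>)
    then show ?thesis
      by (subst (asm) (1) transport_cost_def) (simp only: INF_less_iff)
  qed
  then have "\<forall>i\<in>I. \<exists>\<pi>. \<pi> \<in> couplings (\<mu> i) \<nu> \<and> (\<integral>\<^sup>+z. ennreal (coord_cost p (fst z) (snd z)) \<partial>\<pi>)
      < ennreal (enn2real (transport_cost p (\<mu> i) \<nu>) + e')" by blast
  from bchoice[OF this] obtain \<pi> where "\<forall>i\<in>I. \<pi> i \<in> couplings (\<mu> i) \<nu> \<and>
      (\<integral>\<^sup>+z. ennreal (coord_cost p (fst z) (snd z)) \<partial>\<pi> i)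
      < ennreal (enn2real (transport_cost p (\<mu> i) \<nu>) + e')" ..
  then have \<pi>: "\<And>i. i \<in> I \<Longrightarrow> \<pi> i \<in> couplings (\<mu> i) \<nu>"
    and cost: "\<And>i. i \<in> I \<Longrightarrow> (\<integral>\<^sup>+z. ennreal (coord_cost p (fst z) (snd z)) \<partial>\<pi> i)
      < ennreal (enn2real (transport_cost p (\<mu> i) \<nu>) + e')" by blast+
  let ?L = "\<Sum>i\<in>I. \<Sum>j\<in>I. transport_cost p (\<mu> i) (\<mu> j)"
  have "?L \<le> ennreal (star_const p) * of_nat (card I) *
        (\<Sum>i\<in>I. \<integral>\<^sup>+z. ennreal (coord_cost p (fst z) (snd z)) \<partial>\<pi> i)"
  proof (rule LIMSEQ_le_const)
    show "(\<lambda>n. ennreal (star_const p) * of_nat (card I) *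
        (\<Sum>i\<in>I. \<integral>\<^sup>+z. ennreal (fuzzy_cost p (inverse (real (Suc n))) (fst z) (snd z)) \<partial>\<pi> i))
      \<longlonglongrightarrow> ennreal (star_const p) * of_nat (card I) *
        (\<Sum>i\<in>I. \<integral>\<^sup>+z. ennreal (coord_cost p (fst z) (snd z)) \<partial>\<pi> i)"
    proof (intro ennreal_tendsto_cmult tendsto_sum nn_integral_fuzzy_cost_tendsto p)
      fix i assume i: "i \<in> I"
      show "sets (\<pi> i) = sets borel" using \<pi>[OF i] by (simp add: couplings_def)
      show "finite_measure (\<pi> i)" using \<pi>[OF i] by (simp add: couplings_def prob_space.finite_measure)
      show "(\<integral>\<^sup>+z. ennreal (coord_cost p (fst z) (snd z)) \<partial>\<pi> i) < \<infinity>"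
        using cost[OF i] by (rule less_trans) simp
    qed (simp add: ennreal_mult_less_top of_nat_less_top)
    show "\<exists>N. \<forall>n\<ge>N. ?L \<le> ennreal (star_const p) * of_nat (card I) *
        (\<Sum>i\<in>I. \<integral>\<^sup>+z. ennreal (fuzzy_cost p (inverse (real (Suc n))) (fst z) (snd z)) \<partial>\<pi> i)"
      using sum_transport_cost_le_fuzzy[OF I \<pi> wasserstein_spaceD[OF \<nu>] p] by auto
  qed
  also have "\<dots> \<le> ennreal (star_const p) * of_nat (card I) * (\<Sum>i\<in>I. ennreal (enn2real (transport_cost p (\<mu> i) \<nu>) + e'))"
    by (intro mult_left_mono sum_mono less_imp_le[OF cost]) auto
  also have "\<dots> = ennreal (?K * (\<Sum>i\<in>I. enn2real (transport_cost p (\<mu> i) \<nu>) + e'))"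
    using e' by (subst sum_ennreal) (auto simp: ennreal_mult star_const_def sum_nonneg ennreal_of_nat_eq_real_of_nat)
  finally have "?L \<le> ennreal (?K * (\<Sum>i\<in>I. enn2real (transport_cost p (\<mu> i) \<nu>) + e'))" .
  moreover have "?L = ennreal (\<Sum>i\<in>I. \<Sum>j\<in>I. enn2real (transport_cost p (\<mu> i) (\<mu> j)))"
  proof -
    have "?L = (\<Sum>i\<in>I. \<Sum>j\<in>I. ennreal (enn2real (transport_cost p (\<mu> i) (\<mu> j))))"
      by (intro sum.cong refl ennreal_cost \<mu>)
    then show ?thesis by (simp add: sum_nonneg)
  qed
  ultimately have "(\<Sum>i\<in>I. \<Sum>j\<in>I. enn2real (transport_cost p (\<mu> i) (\<mu> j)))
      \<le> ?K * (\<Sum>i\<in>I. enn2real (transport_cost p (\<mu> i) \<nu>) + e')"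
  proof -
    assume "?L \<le> ennreal (?K * (\<Sum>i\<in>I. enn2real (transport_cost p (\<mu> i) \<nu>) + e'))"
      and "?L = ennreal (\<Sum>i\<in>I. \<Sum>j\<in>I. enn2real (transport_cost p (\<mu> i) (\<mu> j)))"
    moreover have "0 \<le> ?K * (\<Sum>i\<in>I. enn2real (transport_cost p (\<mu> i) \<nu>) + e')"
      using e' by (intro mult_nonneg_nonneg[OF K] sum_nonneg) simp
    ultimately show ?thesis by (simp only: ennreal_le_iff)
  qed
  also have "\<dots> = ?K * (\<Sum>i\<in>I. enn2real (transport_cost p (\<mu> i) \<nu>)) + ?K * card I * e'"
    by (simp add: sum.distrib algebra_simps)
  also have "?K * card I * e' \<le> e"
  proof -
    have "0 < ?K * card I + 1" by (intro add_nonneg_pos mult_nonneg_nonneg) (auto simp: star_const_def)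
    then have "(?K * card I + 1) * e' = e" by (simp add: e'_def)
    then show ?thesis using e' by (simp add: distrib_right)
  qed
  finally show "(\<Sum>i\<in>I. \<Sum>j\<in>I. enn2real (transport_cost p (\<mu> i) (\<mu> j)))
      \<le> ?K * (\<Sum>i\<in>I. enn2real (transport_cost p (\<mu> i) \<nu>)) + e" by simp
qed

section \<open>Random walk on the discrete cube\<close>

definition words :: "nat \<Rightarrow> nat \<Rightarrow> nat list set"
  where "words k t = {l. set l \<subseteq> {..<k} \<and> length l = t}"

text \<open>
  The position, after flipping the coordinates listed in a word one by one, of a walk started at
  the empty set.
\<close>

primrec endpoint :: "nat list \<Rightarrow> nat set"
  where "endpoint [] = {}"
  | "endpoint (i # l) = sym_diff {i} (endpoint l)"

lemma finite_words: "finite (words k t)"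
  unfolding words_def by (simp add: finite_lists_length_eq)

lemma card_words: "card (words k t) = k ^ t"
  unfolding words_def by (simp add: card_lists_length_eq)

lemma sum_words_Suc: "(\<Sum>l\<in>words k (Suc t). h l) = (\<Sum>l\<in>words k t. \<Sum>i<k. h (i # l))"
proof -
  have "words k (Suc t) = (\<lambda>(l, i). i # l) ` (words k t \<times> {..<k})"
    by (auto simp: words_def length_Suc_conv image_iff)
  then have "(\<Sum>l\<in>words k (Suc t). h l) = (\<Sum>(l, i)\<in>words k t \<times> {..<k}. h (i # l))"
    by (simp add: sum.reindex inj_on_def split_def)
  then show ?thesis by (simp add: sum.cartesian_product)
qed

lemma sum_words_add: "(\<Sum>l\<in>words k (s + t). h l) = (\<Sum>l\<in>words k s. \<Sum>l'\<in>words k t. h (l @ l'))"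
proof -
  have "words k (s + t) = (\<lambda>(l, l'). l @ l') ` (words k s \<times> words k t)"
  proof (intro set_eqI iffI)
    fix l assume l: "l \<in> words k (s + t)"
    have "take s l \<in> words k s" "drop s l \<in> words k t"
      using l set_take_subset[of s l] set_drop_subset[of s l] by (auto simp: words_def)
    then show "l \<in> (\<lambda>(l, l'). l @ l') ` (words k s \<times> words k t)"
      by (intro image_eqI[of _ _ "(take s l, drop s l)"]) auto
  qed (auto simp: words_def)
  moreover have "inj_on (\<lambda>(l, l'). l @ l') (words k s \<times> words k t)"
    by (auto simp: inj_on_def words_def)
  ultimately show ?thesis by (simp add: sum.reindex sum.cartesian_product split_def)
qed

lemma endpoint_append: "endpoint (l @ l') = sym_diff (endpoint l) (endpoint l')"
  by (induction l) auto

lemma endpoint_subset: "set l \<subseteq> {..<k} \<Longrightarrow> endpoint l \<subseteq> {..<k}"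
  by (induction l) auto

lemma card_endpoint_le: "card (endpoint l) \<le> length l"
proof (induction l)
  case (Cons i l)
  have "finite (endpoint l)"  by (induction l) auto
  then have "card (endpoint (i # l)) \<le> Suc (card (endpoint l))"
    by (cases "i \<in> endpoint l") (auto simp: card_Diff_singleton_if insert_Diff_if card_insert_if Un_commute)
  then show ?case using Cons by simp
qed simp

text \<open>
  A flip decreases the distance to the start for the coordinates in \<open>S\<close> and increases it for all
  others, so its drift is \<open>1 - 2 card S / k\<close>.
\<close>

lemma sum_card_flip:
  assumes "S \<subseteq> {..<k}"
  shows "(\<Sum>i<k. real (card (sym_diff {i} S))) = real k * card S + k - 2 * card S"
proof -
  have fin: "finite S" using assms finite_subset by blast
  have flip: "real (card (sym_diff {i} S)) = real (card S) + 1 - 2 * indicator S i" for i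
  proof (cases "i \<in> S")
    case True
    then have "sym_diff {i} S = S - {i}" by auto
    moreover have "card S > 0" using True fin by (auto simp: card_gt_0_iff)
    ultimately show ?thesis using True fin by (simp add: of_nat_diff)
  next
    case False
    then have "sym_diff {i} S = insert i S" by auto
    then show ?thesis using False fin by simp
  qed
  have "(\<Sum>i<k. indicator S i) = (\<Sum>i\<in>S. 1 :: real)"
    using assms by (intro sum.mono_neutral_cong_right) (auto simp: indicator_def)
  then have count: "(\<Sum>i<k. indicator S i :: real) = card S" by simp
  have "(\<Sum>i<k. real (card S) + 1 - 2 * indicator S i)
      = real k * (real (card S) + 1) - 2 * (\<Sum>i<k. indicator S i)"
    by (simp only: sum_subtractf sum_distrib_left[symmetric] sum_constant card_lessThan)
  then show ?thesis unfolding flip count by (simp add: algebra_simps)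
qed

text \<open>
  Up to time \<open>k / 4\<close> at most a quarter of the coordinates have been flipped, hence the drift stays
  at least one half: on average the walk moves away at linear speed.
\<close>

lemma mean_card_endpoint_ge:
  assumes "4 * t \<le> k"
  shows "real k ^ t * (real t / 2) \<le> (\<Sum>l\<in>words k t. real (card (endpoint l)))"
  using assms
proof (induction t)
  case 0
  then show ?case by (simp add: words_def)
next
  case (Suc t)
  let ?A = "\<Sum>l\<in>words k t. real (card (endpoint l))"
  have A: "?A \<le> real k ^ t * t"
    using sum_mono[of "words k t" "\<lambda>l. real (card (endpoint l))" "\<lambda>_. real t"] card_endpoint_le
    by (fastforce simp: words_def[of k t] card_words[unfolded words_def])
  have "(\<Sum>l\<in>words k (Suc t). real (card (endpoint l)))
      = (\<Sum>l\<in>words k t. real k * card (endpoint l) + k - 2 * card (endpoint l))"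
    unfolding sum_words_Suc endpoint.simps
    by (intro sum.cong refl sum_card_flip endpoint_subset) (simp add: words_def)
  also have "\<dots> = real k * ?A + real k ^ t * k - 2 * ?A"
    by (simp add: sum.distrib sum_subtractf card_words flip: sum_distrib_left)
  also have "\<dots> \<ge> real k * (real k ^ t * (real t / 2)) + real k ^ t * k - 2 * (real k ^ t * t)"
    using A Suc by (intro add_mono diff_mono mult_left_mono) auto
  moreover have "real k ^ t * (2 * t) \<le> real k ^ t * (k / 2)"
    using Suc.prems by (intro mult_left_mono) auto
  ultimately show ?case by (simp add: field_simps)
qed

text \<open>
  The distance never exceeds \<open>t\<close> and has mean at least \<open>t / 2\<close>, so it is at least \<open>t / 4\<close> with
  probability at least \<open>1 / 4\<close>. The pointwise bound \<open>pw\<close> below encodes this tail estimate.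
\<close>

lemma mean_card_endpoint_powr_ge:
  assumes "4 * t \<le> k" "0 < t" "0 < q"
  shows "real k ^ t * ((real t / 4) powr q / 4)
    \<le> (\<Sum>l\<in>words k t. real (card (endpoint l)) powr q)"
proof -
  \<comment> \<open>For \<open>r < t / 4\<close> the left-hand side is negative; otherwise \<open>r / t - 1 / 4 \<le> 1\<close>.\<close>
  have pw: "(real t / 4) powr q * (r / t - 1 / 4) \<le> r powr q" if "0 \<le> r" "r \<le> t" for r :: real
  proof (cases "r \<ge> t / 4")
    case True
    have "(real t / 4) powr q * (r / t - 1 / 4) \<le> (real t / 4) powr q * 1"
      using that assms by (intro mult_left_mono) (auto simp: field_simps)
    also have "\<dots> \<le> r powr q" using True assms by (simp add: powr_mono2)
    finally show ?thesis .
  next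
    case False
    then have "(real t / 4) powr q * (r / t - 1 / 4) \<le> 0"
      using assms by (intro mult_nonneg_nonpos) (auto simp: field_simps)
    then show ?thesis by (meson order_trans powr_ge_zero)
  qed
  have "real k ^ t * ((real t / 4) powr q / 4)
      = (real t / 4) powr q * (real k ^ t * (real t / 2) / t - real k ^ t * (1 / 4))"
    using assms by (simp add: field_simps)
  also have "\<dots> \<le> (real t / 4) powr q * ((\<Sum>l\<in>words k t. real (card (endpoint l))) / t - real k ^ t * (1 / 4))"
    using mean_card_endpoint_ge[OF assms(1)] by (intro mult_left_mono diff_right_mono divide_right_mono) auto
  also have "\<dots> = (\<Sum>l\<in>words k t. (real t / 4) powr q * (real (card (endpoint l)) / t - 1 / 4))"
    by (simp add: sum_subtractf card_words flip: sum_distrib_left sum_divide_distrib)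
  also have "\<dots> \<le> (\<Sum>l\<in>words k t. real (card (endpoint l)) powr q)"
  proof (rule sum_mono)
    fix l assume "l \<in> words k t"
    then have "real (card (endpoint l)) \<le> t" using card_endpoint_le[of l] by (simp add: words_def)
    then show "(real t / 4) powr q * (real (card (endpoint l)) / t - 1 / 4) \<le> real (card (endpoint l)) powr q"
      by (intro pw) simp_all
  qed
  finally show ?thesis .
qed

text \<open>
  The mean of \<open>F\<close> between the positions at times \<open>t\<close> and \<open>0\<close> of the simple random walk with
  uniformly distributed start.
\<close>

definition displacement :: "(nat set \<Rightarrow> nat set \<Rightarrow> real) \<Rightarrow> nat \<Rightarrow> nat \<Rightarrow> real"
  where "displacement F k t =
    (\<Sum>x\<in>Pow {..<k}. \<Sum>l\<in>words k t. F (sym_diff x (endpoint l)) x) / (2 ^ k * real k ^ t)"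

text \<open>
  Two independent walks of length \<open>t\<close> from \<open>x\<close> form, by reversibility, a walk of length \<open>2 t\<close>
  between their endpoints whose midpoint is \<open>x\<close>. The hypothesis is the star inequality centred at
  that midpoint; averaging over \<open>x\<close> uses translation invariance of the uniform distribution.
\<close>

lemma displacement_double:
  assumes star: "\<And>x. x \<subseteq> {..<k} \<Longrightarrow>
      (\<Sum>l\<in>words k t. \<Sum>l'\<in>words k t. F (sym_diff x (endpoint l)) (sym_diff x (endpoint l')))
      \<le> K * real k ^ t * (\<Sum>l\<in>words k t. F (sym_diff x (endpoint l)) x)"
    and "0 < k"
  shows "displacement F k (t + t) \<le> K * displacement F k t"
proof -
  let ?P = "Pow {..<k}"
  have shift: "(\<Sum>x\<in>?P. F (sym_diff x (endpoint l)) (sym_diff x (endpoint l')))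
      = (\<Sum>x\<in>?P. F (sym_diff x (endpoint (l @ l'))) x)" if "l' \<in> words k t" for l l'
  proof (rule sum.reindex_bij_witness[of _ "\<lambda>x. sym_diff x (endpoint l')" "\<lambda>x. sym_diff x (endpoint l')"])
    fix x assume "x \<in> ?P"
    have "endpoint l' \<subseteq> {..<k}" using that by (simp add: words_def endpoint_subset)
    with \<open>x \<in> ?P\<close> show "sym_diff x (endpoint l') \<in> ?P" "sym_diff x (endpoint l') \<in> ?P" by auto
    show "sym_diff (sym_diff x (endpoint l')) (endpoint l') = x"
      "sym_diff (sym_diff x (endpoint l')) (endpoint l') = x" by auto
    have "sym_diff (sym_diff x (endpoint l')) (endpoint (l @ l')) = sym_diff x (endpoint l)"
      unfolding endpoint_append by auto
    then show "F (sym_diff (sym_diff x (endpoint l')) (endpoint (l @ l'))) (sym_diff x (endpoint l'))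
        = F (sym_diff x (endpoint l)) (sym_diff x (endpoint l'))" by simp
  qed
  have "(\<Sum>x\<in>?P. \<Sum>l\<in>words k (t + t). F (sym_diff x (endpoint l)) x)
      = (\<Sum>l\<in>words k t. \<Sum>l'\<in>words k t. \<Sum>x\<in>?P. F (sym_diff x (endpoint (l @ l'))) x)"
    by (simp only: sum_words_add sum.swap[of _ _ ?P])
  also have "\<dots> = (\<Sum>l\<in>words k t. \<Sum>l'\<in>words k t. \<Sum>x\<in>?P. F (sym_diff x (endpoint l)) (sym_diff x (endpoint l')))"
    by (intro sum.cong refl shift[symmetric])
  also have "\<dots> = (\<Sum>x\<in>?P. \<Sum>l\<in>words k t. \<Sum>l'\<in>words k t. F (sym_diff x (endpoint l)) (sym_diff x (endpoint l')))"
    by (simp only: sum.swap[of _ _ ?P])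
  also have "\<dots> \<le> (\<Sum>x\<in>?P. K * real k ^ t * (\<Sum>l\<in>words k t. F (sym_diff x (endpoint l)) x))"
    by (intro sum_mono star) auto
  finally have "(\<Sum>x\<in>?P. \<Sum>l\<in>words k (t + t). F (sym_diff x (endpoint l)) x)
     \<le> K * real k ^ t * (\<Sum>x\<in>?P. \<Sum>l\<in>words k t. F (sym_diff x (endpoint l)) x)"
    by (simp add: sum_distrib_left)
  then have "displacement F k (t + t) \<le> (K * real k ^ t * (\<Sum>x\<in>?P. \<Sum>l\<in>words k t. F (sym_diff x (endpoint l)) x)) / (2 ^ k * real k ^ (t + t))"
    unfolding displacement_def by (intro divide_right_mono) auto
  also have "\<dots> = K * displacement F k t"
    using assms(2) by (simp add: displacement_def power_add)
  finally show ?thesis .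
qed

lemma displacement_power_two:
  assumes star: "\<And>x t. x \<subseteq> {..<k} \<Longrightarrow>
      (\<Sum>l\<in>words k t. \<Sum>l'\<in>words k t. F (sym_diff x (endpoint l)) (sym_diff x (endpoint l')))
      \<le> K * real k ^ t * (\<Sum>l\<in>words k t. F (sym_diff x (endpoint l)) x)"
    and "0 < k" "0 \<le> K"
  shows "displacement F k (2 ^ j) \<le> K ^ j * displacement F k 1"
proof (induction j)
  case (Suc j)
  have "displacement F k (2 ^ Suc j) \<le> K * displacement F k (2 ^ j)"
    using displacement_double[OF star assms(2), of "2 ^ j"] by (simp add: mult_2)
  also have "\<dots> \<le> K * (K ^ j * displacement F k 1)"
    using Suc assms by (intro mult_left_mono) auto
  finally show ?case by simp
qed simp

text \<open>
  Compares the two ends of the doubling argument: after \<open>t = 2\<^sup>j = k / 4\<close> steps the walk is at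
  distance of order \<open>t\<close>, which bounds the displacement from below, while \<open>j\<close> doublings starting
  from a single step bound it from above.
\<close>

lemma cube_growth_bound:
  fixes F :: "nat set \<Rightarrow> nat set \<Rightarrow> real"
  assumes star: "\<And>I g x. finite I \<Longrightarrow> (\<And>i. i \<in> I \<Longrightarrow> g i \<subseteq> {..<k}) \<Longrightarrow> x \<subseteq> {..<k} \<Longrightarrow>
      (\<Sum>i\<in>(I :: nat list set). \<Sum>j\<in>I. F (g i) (g j)) \<le> K * real (card I) * (\<Sum>i\<in>I. F (g i) x)"
    and lower: "\<And>S S'. S \<subseteq> {..<k} \<Longrightarrow> S' \<subseteq> {..<k} \<Longrightarrow> a * real (card (sym_diff S S')) powr q \<le> F S S'"
    and upper: "\<And>S S'. S \<subseteq> {..<k} \<Longrightarrow> S' \<subseteq> {..<k} \<Longrightarrow> card (sym_diff S S') = 1 \<Longrightarrow> F S S' \<le> b"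
    and k: "k = 4 * 2 ^ j" and "0 \<le> a" "0 < q" "0 \<le> K"
  shows "a * ((2 ^ j / 4) powr q / 4) \<le> K ^ j * b"
proof -
  have k0: "0 < k" using k by simp
  have sd: "sym_diff (sym_diff x y) x = y" for x y :: "nat set" by auto
  have sub: "endpoint l \<subseteq> {..<k}" if "l \<in> words k t" for l t
    using that by (simp add: words_def endpoint_subset)
  have sub': "sym_diff x (endpoint l) \<subseteq> {..<k}" if "x \<subseteq> {..<k}" "l \<in> words k t" for x l t
    using that(1) sub[OF that(2)] by auto
  have star': "(\<Sum>l\<in>words k t. \<Sum>l'\<in>words k t. F (sym_diff x (endpoint l)) (sym_diff x (endpoint l')))
      \<le> K * real k ^ t * (\<Sum>l\<in>words k t. F (sym_diff x (endpoint l)) x)" if "x \<subseteq> {..<k}" for x t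
    using star[of "words k t" "\<lambda>l. sym_diff x (endpoint l)" x] sub' that
    by (simp add: finite_words card_words)
  have "a * ((2 ^ j / 4) powr q / 4) = (\<Sum>x\<in>Pow {..<k}. a * (real k ^ 2 ^ j * ((real (2 ^ j) / 4) powr q / 4))) / (2 ^ k * real k ^ 2 ^ j)"
    using k0 by (simp add: card_Pow)
  also have "\<dots> \<le> (\<Sum>x\<in>Pow {..<k}. a * (\<Sum>l\<in>words k (2 ^ j). real (card (endpoint l)) powr q)) / (2 ^ k * real k ^ 2 ^ j)"
    using k assms(5,6) by (intro divide_right_mono sum_mono mult_left_mono mean_card_endpoint_powr_ge) auto
  also have "\<dots> \<le> displacement F k (2 ^ j)"
    unfolding displacement_def sum_distrib_left
  proof (intro divide_right_mono sum_mono)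
    fix x l assume x: "x \<in> Pow {..<k}" and l: "l \<in> words k (2 ^ j)"
    show "a * real (card (endpoint l)) powr q \<le> F (sym_diff x (endpoint l)) x"
      using lower[OF sub'[OF _ l], of x x] x unfolding sd by simp
  qed simp
  also have "\<dots> \<le> K ^ j * displacement F k 1"
    by (intro displacement_power_two star' k0 \<open>0 \<le> K\<close>)
  also have "\<dots> \<le> K ^ j * b"
  proof (rule mult_left_mono)
    have "displacement F k 1 \<le> (\<Sum>x\<in>Pow {..<k}. \<Sum>l\<in>words k 1. b) / (2 ^ k * real k ^ 1)"
      unfolding displacement_def
    proof (intro divide_right_mono sum_mono)
      fix x l assume x: "x \<in> Pow {..<k}" and l: "l \<in> words k 1"
      have "card (sym_diff (sym_diff x (endpoint l)) x) = 1"
        using l unfolding sd by (auto simp: words_def length_Suc_conv)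
      then show "F (sym_diff x (endpoint l)) x \<le> b"
        using sub'[OF _ l, of x] x by (intro upper) auto
    qed simp
    also have "\<dots> = b" using k0 by (simp add: card_words card_Pow)
    finally show "displacement F k 1 \<le> b" .
  qed (use \<open>0 \<le> K\<close> in simp)
  finally show ?thesis .
qed

text \<open>
  The logarithm of the number of points of the cube is \<open>4 t ln 2\<close>, and \<open>1 \<le> 4 ln 2 \<le> 4\<close>.
\<close>

lemma powr_ln_card_cube_le:
  fixes t :: nat and e :: real
  assumes "0 < t" "-1 \<le> e" "e \<le> 1"
  shows "ln (real (2 ^ (4 * t))) powr e \<le> 4 * real t powr e"
proof -
  have L: "ln (real (2 ^ (4 * t))) = (4 * ln 2) * real t" by (simp add: ln_realpow)
  have c: "1 \<le> 4 * ln (2::real)" "4 * ln (2::real) \<le> 4"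
    using ln_le_minus_one[of "1 / 2 :: real"] ln_le_minus_one[of "2 :: real"] by (simp_all add: ln_div)
  have "(4 * ln 2 :: real) powr e \<le> (4 * ln 2) powr 1" using c assms by (intro powr_mono) auto
  also have "\<dots> \<le> 4" using c by simp
  finally have "(4 * ln 2) powr e * real t powr e \<le> 4 * real t powr e" by (intro mult_right_mono) auto
  then show ?thesis using c unfolding L by (simp add: powr_mult)
qed

section \<open>Distortion of snowflakes of the cube\<close>

definition lower_exponent :: "real \<Rightarrow> real \<Rightarrow> real"
  where "lower_exponent p \<alpha> = (if p \<le> 2 then \<alpha> - 1 / p else \<alpha> + 1 / p - 1)"

text \<open>
  Distances of the snowflake grow like \<open>t powr \<alpha>\<close> along the walk, whereas by the star inequality
  displacements in the Wasserstein space grow at most like \<open>t powr (max 1 (p - 1) / p)\<close>; the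
  quotient is the claimed lower bound. The constant is \<open>144 = 4 * 3 * 12\<close>: a factor \<open>4\<close> and a
  factor \<open>3\<close> from the distance bound \<open>t / 4\<close> and the comparison of norms, and
  \<open>12 = 3 * 4\<close> from the reverse comparison of norms and the probability \<open>1 / 4\<close>.
\<close>

lemma snowflake_cube_distortion_ge:
  fixes m :: "nat set \<Rightarrow> (real ^ 3) measure"
  assumes p: "1 < p" and \<alpha>: "0 < \<alpha>" "\<alpha> \<le> 1" and s: "0 < s" and D: "0 \<le> D"
    and k: "k = 4 * 2 ^ j"
    and m: "\<And>S. S \<subseteq> {..<k} \<Longrightarrow> m S \<in> wasserstein_space p"
    and lower: "\<And>S S'. S \<subseteq> {..<k} \<Longrightarrow> S' \<subseteq> {..<k} \<Longrightarrow>
        s * real (card (sym_diff S S')) powr \<alpha> \<le> wasserstein_dist p (m S) (m S')"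
    and upper: "\<And>S S'. S \<subseteq> {..<k} \<Longrightarrow> S' \<subseteq> {..<k} \<Longrightarrow>
        wasserstein_dist p (m S) (m S') \<le> D * (s * real (card (sym_diff S S')) powr \<alpha>)"
  shows "real (2 ^ j) powr lower_exponent p \<alpha> / 144 \<le> D"
proof -
  define F where "F S S' = enn2real (transport_cost p (m S) (m S'))" for S S'
  have F_nonneg: "0 \<le> F S S'" for S S' by (simp add: F_def)
  define t where "t = real (2 ^ j)"
  have t: "1 \<le> t" by (simp add: t_def)
  have W_le_F: "wasserstein_dist p (m S) (m S') powr p \<le> 3 powr p * F S S'"
    and F_le_W: "F S S' \<le> 3 * wasserstein_dist p (m S) (m S') powr p"
    if "S \<subseteq> {..<k}" "S' \<subseteq> {..<k}" for S S'
  proof -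
    note le = transport_cost_le_wasserstein_dist[OF p m[OF that(1)] m[OF that(2)]]
    have "transport_cost p (m S) (m S') < \<top>" using le by (rule le_less_trans) simp
    then have eq: "transport_cost p (m S) (m S') = ennreal (F S S')" by (simp add: F_def)
    show "F S S' \<le> 3 * wasserstein_dist p (m S) (m S') powr p"
      using le by (simp add: eq)
    have "ennreal (wasserstein_dist p (m S) (m S') powr p) \<le> ennreal (3 powr p * F S S')"
      using wasserstein_dist_le_transport_cost[OF p m[OF that(1)] m[OF that(2)]]
      by (simp add: eq ennreal_mult F_nonneg)
    then show "wasserstein_dist p (m S) (m S') powr p \<le> 3 powr p * F S S'"
      by (simp add: ennreal_le_iff F_nonneg)
  qed
  have "(s powr p / 3 powr p) * ((2 ^ j / 4) powr (\<alpha> * p) / 4) \<le> star_const p ^ j * (3 * (D * s) powr p)"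
  proof (rule cube_growth_bound[where F = F and k = k])
    show "(\<Sum>i\<in>I. \<Sum>j\<in>I. F (g i) (g j)) \<le> star_const p * real (card I) * (\<Sum>i\<in>I. F (g i) x)"
      if "finite I" "\<And>i. i \<in> I \<Longrightarrow> g i \<subseteq> {..<k}" "x \<subseteq> {..<k}" for I :: "nat list set" and g x
      unfolding F_def using that by (intro sum_transport_cost_le p m) auto
  next
    fix S S' :: "nat set" assume S: "S \<subseteq> {..<k}" "S' \<subseteq> {..<k}"
    have "(s * real (card (sym_diff S S')) powr \<alpha>) powr p \<le> wasserstein_dist p (m S) (m S') powr p"
      using p s lower[OF S] by (intro powr_mono2) auto
    also note W_le_F[OF S]
    finally show "s powr p / 3 powr p * real (card (sym_diff S S')) powr (\<alpha> * p) \<le> F S S'"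
      using s by (simp add: powr_mult powr_powr field_simps)
    assume 1: "card (sym_diff S S') = 1"
    have "0 \<le> wasserstein_dist p (m S) (m S')"
      using lower[OF S] s 1 by simp
    then have "wasserstein_dist p (m S) (m S') powr p \<le> (D * s) powr p"
      using p upper[OF S] 1 by (intro powr_mono2) auto
    then show "F S S' \<le> 3 * (D * s) powr p" using F_le_W[OF S] by linarith
  qed (use p \<alpha> k in \<open>auto simp: star_const_def\<close>)
  also have "star_const p ^ j = t powr max 1 (p - 1)"
    by (simp add: star_const_def t_def powr_power powr_powr mult.commute flip: powr_realpow)
  finally have main: "s powr p * ((t / 4) powr (\<alpha> * p)) \<le> s powr p * (12 * 3 powr p * t powr max 1 (p - 1) * D powr p)"
    using s D by (simp add: t_def powr_mult field_simps)
  then have "(t / 4) powr (\<alpha> * p) \<le> 12 * 3 powr p * t powr max 1 (p - 1) * D powr p"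
    using s by simp
  then have "((t / 4) powr (\<alpha> * p)) powr (1 / p) \<le> (12 * 3 powr p * t powr max 1 (p - 1) * D powr p) powr (1 / p)"
    using p by (intro powr_mono2) auto
  also have "((t / 4) powr (\<alpha> * p)) powr (1 / p) = (t / 4) powr \<alpha>" using p by (simp add: powr_powr)
  also have "(12 * 3 powr p * t powr max 1 (p - 1) * D powr p) powr (1 / p)
      = 12 powr (1 / p) * 3 * t powr (max 1 (p - 1) / p) * D"
    using p D by (simp add: powr_mult powr_powr)
  also have "\<dots> \<le> 12 powr 1 * 3 * t powr (max 1 (p - 1) / p) * D"
    using p D by (intro mult_right_mono powr_mono) auto
  finally have "(t / 4) powr \<alpha> \<le> 36 * t powr (max 1 (p - 1) / p) * D" by simp
  moreover have "t powr \<alpha> / 4 \<le> (t / 4) powr \<alpha>"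
  proof -
    have "4 powr \<alpha> \<le> (4::real)" using \<alpha> powr_mono[of \<alpha> 1 4] by simp
    then have "t powr \<alpha> / 4 \<le> t powr \<alpha> / 4 powr \<alpha>" by (intro divide_left_mono) auto
    then show ?thesis using t by (simp add: powr_divide)
  qed
  ultimately have "t powr \<alpha> \<le> 144 * t powr (max 1 (p - 1) / p) * D" by linarith
  moreover have "t powr lower_exponent p \<alpha> = t powr \<alpha> / t powr (max 1 (p - 1) / p)"
    using p t by (simp add: lower_exponent_def max_def field_simps flip: powr_diff)
  moreover have "0 < t powr (max 1 (p - 1) / p)" using t by simp
  ultimately have "t powr lower_exponent p \<alpha> \<le> 144 * D" by (simp add: pos_divide_le_eq mult_ac)
  then show ?thesis by (simp add: t_def)
qed

theorem theorem2:
  shows "\<exists>c::real. c > 0 \<and> (\<forall>p::real. p > 1 \<longrightarrow>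
    (\<forall>N::nat. \<exists>n\<ge>N. \<exists>(X::nat set) d. finite X \<and> card X = n \<and> Metric_space X d \<and>
      (\<forall>\<alpha>::real. 0 < \<alpha> \<and> \<alpha> \<le> 1 \<longrightarrow>
        distortion_inf (wasserstein_space p :: (real ^ 3) measure set) (wasserstein_dist p)
            X (\<lambda>x y. d x y powr \<alpha>)
          \<ge> ereal (if p \<le> 2 then c * ln (real n) powr (\<alpha> - 1 / p)
                   else c * ln (real n) powr (\<alpha> + 1 / p - 1)))))"
  \<comment> \<open>\<open>576 = 144 * 4\<close>: the factor \<open>4\<close> is lost in passing from \<open>t\<close> to the logarithm of \<open>n\<close>.\<close>
proof (intro exI[of _ "1 / 576"] conjI allI impI)
  fix p :: real and N :: nat assume p: "1 < p"
  define k :: nat where "k = 4 * 2 ^ N"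
  define n :: nat where "n = 2 ^ k"
  have "N \<le> n"
  proof -
    have "N < 2 ^ N" by (rule less_exp)
    also have "\<dots> \<le> k" by (simp add: k_def)
    also have "\<dots> < n" unfolding n_def by (rule less_exp)
    finally show ?thesis by simp
  qed
  \<comment> \<open>The points of the cube are the subsets of \<open>{..<k}\<close>; \<open>e\<close> decodes numbers below \<open>n\<close>.\<close>
  have "card {..<n} = card (Pow {..<k})" by (simp add: n_def card_Pow)
  then obtain e where e: "bij_betw e {..<n} (Pow {..<k})"
    using finite_same_card_bij[of "{..<n}" "Pow {..<k}"] by auto
  define d where "d x y = real (card (sym_diff (e x) (e y)))" for x y
  have fin: "finite (e x)" "e x \<subseteq> {..<k}" if "x \<in> {..<n}" for x
    using bij_betwE[OF e] that finite_subset[of "e x" "{..<k}"] by auto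
  have metric: "Metric_space {..<n} d"
  proof
    fix x y z assume xyz: "x \<in> {..<n}" "y \<in> {..<n}" "z \<in> {..<n}"
    show "d x z \<le> d x y + d y z"
    proof -
      have "card (sym_diff (e x) (e z)) \<le> card (sym_diff (e x) (e y) \<union> sym_diff (e y) (e z))"
        using xyz fin by (intro card_mono) auto
      also have "\<dots> \<le> card (sym_diff (e x) (e y)) + card (sym_diff (e y) (e z))" by (rule card_Un_le)
      finally show ?thesis unfolding d_def by linarith
    qed
  next
    fix x y assume xy: "x \<in> {..<n}" "y \<in> {..<n}"
    have "d x y = 0 \<longleftrightarrow> e x = e y" using fin xy by (auto simp: d_def)
    then show "d x y = 0 \<longleftrightarrow> x = y" using e xy by (auto simp: bij_betw_def inj_on_def)
  qed (simp_all add: d_def Un_commute)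
  have bound: "ereal (if p \<le> 2 then 1 / 576 * ln (real n) powr (\<alpha> - 1 / p)
                   else 1 / 576 * ln (real n) powr (\<alpha> + 1 / p - 1))
      \<le> distortion_inf (wasserstein_space p :: (real ^ 3) measure set) (wasserstein_dist p) {..<n} (\<lambda>x y. d x y powr \<alpha>)"
    if \<alpha>: "0 < \<alpha> \<and> \<alpha> \<le> 1" for \<alpha>
    unfolding distortion_inf_def
  proof (rule Inf_greatest, clarify)
    fix D :: ereal and f :: "nat \<Rightarrow> (real ^ 3) measure"
    assume D1: "1 \<le> D" and f: "f \<in> {..<n} \<rightarrow> wasserstein_space p"
      and dist: "distortion_at_most {..<n} (\<lambda>x y. d x y powr \<alpha>) (wasserstein_dist p) f D"
    obtain s where s: "0 < s"
      and low: "\<And>x y. x \<in> {..<n} \<Longrightarrow> y \<in> {..<n} \<Longrightarrow> s * d x y powr \<alpha> \<le> wasserstein_dist p (f x) (f y)"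
      and up: "\<And>x y. x \<in> {..<n} \<Longrightarrow> y \<in> {..<n} \<Longrightarrow>
          ereal (wasserstein_dist p (f x) (f y)) \<le> D * ereal (s * d x y powr \<alpha>)"
      using dist unfolding distortion_at_most_def by blast
    show "ereal (if p \<le> 2 then 1 / 576 * ln (real n) powr (\<alpha> - 1 / p)
                   else 1 / 576 * ln (real n) powr (\<alpha> + 1 / p - 1)) \<le> D"
    proof (cases D)
      case (real r)
      define g where "g = inv_into {..<n} e"
      have g: "g S \<in> {..<n}" "e (g S) = S" if "S \<subseteq> {..<k}" for S
      proof -
        have "S \<in> e ` {..<n}" using that e by (simp add: bij_betw_def)
        then show "g S \<in> {..<n}" "e (g S) = S"
          unfolding g_def by (rule inv_into_into, rule f_inv_into_f)
      qed
      have "real (2 ^ N) powr lower_exponent p \<alpha> / 144 \<le> r"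
      proof (rule snowflake_cube_distortion_ge[where m = "f \<circ> g", OF p _ _ s _ k_def])
        show "(f \<circ> g) S \<in> wasserstein_space p" if "S \<subseteq> {..<k}" for S
          using f g[OF that] by auto
        show "s * real (card (sym_diff S S')) powr \<alpha> \<le> wasserstein_dist p ((f \<circ> g) S) ((f \<circ> g) S')"
          if "S \<subseteq> {..<k}" "S' \<subseteq> {..<k}" for S S'
          using low[OF g(1)[OF that(1)] g(1)[OF that(2)]] g(2)[OF that(1)] g(2)[OF that(2)] by (simp add: d_def)
        show "wasserstein_dist p ((f \<circ> g) S) ((f \<circ> g) S') \<le> r * (s * real (card (sym_diff S S')) powr \<alpha>)"
          if "S \<subseteq> {..<k}" "S' \<subseteq> {..<k}" for S S'
          using up[OF g(1)[OF that(1)] g(1)[OF that(2)]] g(2)[OF that(1)] g(2)[OF that(2)] by (simp add: d_def real)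
      qed (use \<alpha> D1 real in auto)
      moreover have "ln (real n) powr lower_exponent p \<alpha> \<le> 4 * real (2 ^ N) powr lower_exponent p \<alpha>"
        unfolding n_def k_def
      proof (rule powr_ln_card_cube_le)
        have "0 < 1 / p" "1 / p < 1" using p by auto
        with \<alpha> show "- 1 \<le> lower_exponent p \<alpha>" "lower_exponent p \<alpha> \<le> 1"
          unfolding lower_exponent_def by (cases "p \<le> 2"; simp only: if_True if_False; linarith)+
      qed simp
      ultimately have "1 / 576 * ln (real n) powr lower_exponent p \<alpha> \<le> r" by linarith
      then show ?thesis by (simp add: real lower_exponent_def split: if_splits)
    qed (use D1 in auto)
  qed
  show "\<exists>n\<ge>N. \<exists>(X::nat set) d. finite X \<and> card X = n \<and> Metric_space X d \<and>
      (\<forall>\<alpha>::real. 0 < \<alpha> \<and> \<alpha> \<le> 1 \<longrightarrow>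
        distortion_inf (wasserstein_space p :: (real ^ 3) measure set) (wasserstein_dist p)
            X (\<lambda>x y. d x y powr \<alpha>)
          \<ge> ereal (if p \<le> 2 then 1 / 576 * ln (real n) powr (\<alpha> - 1 / p)
                   else 1 / 576 * ln (real n) powr (\<alpha> + 1 / p - 1)))"
    using \<open>N \<le> n\<close> metric bound
    by (intro exI[of _ n] conjI exI[of _ "{..<n}"] exI[of _ d] allI impI) auto
qed simp

end
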